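(* Let $K$ be a field and let $E=(E^0,E^1,r,s)$ be a row-finite graph with no sinks. Let $(X,\{R_e\}_{e\in E^1},\{D_u\}_{u\in E^0},\{f_e\}_{e\in E^1})$ be the $E$-algebraic branching system, with $X\subseteq \mathbb{R}$, constructed in the context from an enumeration of $E^1$ and a fixed irrational number $\theta\in[0,1)$. Then the representation $\pi:L_K(E)\to\mathrm{Hom}_K(M)$ induced by this $E$-algebraic branching system is faithful (that is, injective).
   Context: A graph $E=(E^0,E^1,r,s)$ is a directed graph with countable vertex set $E^0$, countable edge set $E^1$, and range and source maps $r,s:E^1\to E^0$. It is row-finite if $s^{-1}(v)$ is finite for each $v\in E^0$; a sink is a vertex which emits no edges. The Leavitt path algebra $L_K(E)$ is the universal $K$-algebra (not necessarily unital) generated by a set $\{v:v\in E^0\}$ of pairwise orthogonal idempotents together with elements $\{e,e^*:e\in E^1\}$ satisfying: (1) $s(e)e=er(e)=e$ for all $e\in E^1$; (2) $r(e)e^*=e^*s(e)=e^*$ for all $e\in E^1$; (3) $e^*f=\delta_{e,f}r(e)$ for all $e,f\in E^1$; (4) $v=\sum_{e:s(e)=v}ee^*$ for every vertex $v$ with $0<\#\{e:s(e)=v\}<\infty$. An $E$-algebraic branching system consists of a set $X$, subsets $R_e$ ($e\in E^1$) and $D_v$ ($v\in E^0$) of $X$, and maps $f_e$ such that: the $R_e$ are pairwise disjoint; the $D_v$ are pairwise disjoint; $R_e\subseteq D_{s(e)}$; $D_v=\bigcup_{e:s(e)=v}R_e$ if $0<\#\{e:s(e)=v\}<\infty$; and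 each $f_e:D_{r(e)}\to R_e$ is a bijection. Induced representation: $M$ is the $K$-module of all functions $X\to K$, $\mathrm{Hom}_K(M)$ is the $K$-algebra of $K$-linear maps $M\to M$ under composition, and $\pi$ is the $K$-algebra homomorphism determined by: $\pi(e)(\phi)(x)=\phi(f_e^{-1}(x))$ if $x\in R_e$ and $0$ otherwise; $\pi(e^* )(\phi)(x)=\phi(f_e(x))$ if $x\in D_{r(e)}$ and $0$ otherwise; $\pi(v)(\phi)(x)=\phi(x)$ if $x\in D_v$ and $0$ otherwise. Construction. Enumerate $E^1=\{e_1,e_2,\dots\}$ (finite or infinite, without repetition). Put $R_{e_i}=[i-1,i)$, $D_v=\bigcup_{e\in s^{-1}(v)}R_e$ for $v\in E^0$, and $X=\bigcup_{e\in E^1}R_e$. Fix an irrational $\theta\in[0,1)$ and let $h_\theta:[0,1)\to[0,1)$, $h_\theta(x)=(x+\theta)\bmod 1$. For $a<b$ real let $g_a^b:[0,1)\to[a,b)$, $g_a^b(x)=bx+(1-x)a$. For $e=e_j\in E^1$ write $s^{-1}(r(e))=\{e_{i_1},\dots,e_{i_P}\}$ with $P=\#s^{-1}(r(e))$, so $D_{r(e)}=\bigcup_{k=1}^P R_{e_{i_k}}$. The bijection $f_e:D_{r(e)}\to R_e$ is defined, for $x\in R_{e_{i_k}}=[i_k-1,i_k)$, by $$f_e(x)=\left(g_{(j-1+\frac{k-1}{P})}^{(j-1+\frac{k}{P})}\circ h_\theta\circ\left(g_{(i_k-1)}^{i_k}\right)^{-1}\right)(x).$$ *)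

theory Defs
  imports Complex_Main "HOL-Library.FuncSet" "HOL-Library.Disjoint_Sets" "HOL-Algebra.Module" "Graph_Theory.Digraph"
begin

section \<open>Graphs\<close>

text \<open>
  Graphs are the multi-digraphs of \<^typ>\<open>('v, 'e) pre_digraph\<close>: the source map is
  \<^const>\<open>tail\<close>, the range map is \<^const>\<open>head\<close>, and the set of edges with source \<open>v\<close> is
  \<open>out_arcs E v\<close>.
\<close>

definition countable_graph :: "('v, 'e) pre_digraph \<Rightarrow> bool" where
  "countable_graph E \<longleftrightarrow> wf_digraph E \<and> countable (verts E) \<and> countable (arcs E)"

definition row_finite :: "('v, 'e) pre_digraph \<Rightarrow> bool" where
  "row_finite E \<longleftrightarrow> (\<forall>v\<in>verts E. finite (out_arcs E v))"

definition is_sink :: "('v, 'e) pre_digraph \<Rightarrow> 'v \<Rightarrow> bool" where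
  "is_sink E v \<longleftrightarrow> v \<in> verts E \<and> out_arcs E v = {}"

section \<open>Algebras over a field, not necessarily unital\<close>

text \<open>
  The record \<open>module\<close> of HOL-Algebra carries the operations. Its field \<open>one\<close> plays no role here:
  neither the axioms nor the homomorphisms below mention it.
\<close>

locale field_algebra = abelian_group A for A :: "('k::field, 'a) module" (structure) +
  assumes mult_closed: "x \<in> carrier A \<Longrightarrow> y \<in> carrier A \<Longrightarrow> x \<otimes> y \<in> carrier A"
    and smult_closed: "x \<in> carrier A \<Longrightarrow> c \<odot> x \<in> carrier A"
    and mult_assoc: "x \<in> carrier A \<Longrightarrow> y \<in> carrier A \<Longrightarrow> z \<in> carrier A \<Longrightarrow>
          (x \<otimes> y) \<otimes> z = x \<otimes> (y \<otimes> z)"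
    and l_distr: "x \<in> carrier A \<Longrightarrow> y \<in> carrier A \<Longrightarrow> z \<in> carrier A \<Longrightarrow>
          (x \<oplus> y) \<otimes> z = x \<otimes> z \<oplus> y \<otimes> z"
    and r_distr: "x \<in> carrier A \<Longrightarrow> y \<in> carrier A \<Longrightarrow> z \<in> carrier A \<Longrightarrow>
          z \<otimes> (x \<oplus> y) = z \<otimes> x \<oplus> z \<otimes> y"
    and smult_l_distr: "x \<in> carrier A \<Longrightarrow> (c + d) \<odot> x = c \<odot> x \<oplus> d \<odot> x"
    and smult_r_distr: "x \<in> carrier A \<Longrightarrow> y \<in> carrier A \<Longrightarrow> c \<odot> (x \<oplus> y) = c \<odot> x \<oplus> c \<odot> y"
    and smult_assoc1: "x \<in> carrier A \<Longrightarrow> (c * d) \<odot> x = c \<odot> (d \<odot> x)"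
    and smult_one: "x \<in> carrier A \<Longrightarrow> 1 \<odot> x = x"
    and smult_mult_l: "x \<in> carrier A \<Longrightarrow> y \<in> carrier A \<Longrightarrow> (c \<odot> x) \<otimes> y = c \<odot> (x \<otimes> y)"
    and smult_mult_r: "x \<in> carrier A \<Longrightarrow> y \<in> carrier A \<Longrightarrow> x \<otimes> (c \<odot> y) = c \<odot> (x \<otimes> y)"

definition algebra_hom :: "('k::field, 'a) module \<Rightarrow> ('k, 'b) module \<Rightarrow> ('a \<Rightarrow> 'b) set" where
  "algebra_hom A B = {h \<in> carrier A \<rightarrow> carrier B.
     (\<forall>x\<in>carrier A. \<forall>y\<in>carrier A. h (x \<oplus>\<^bsub>A\<^esub> y) = h x \<oplus>\<^bsub>B\<^esub> h y) \<and>
     (\<forall>x\<in>carrier A. \<forall>y\<in>carrier A. h (x \<otimes>\<^bsub>A\<^esub> y) = h x \<otimes>\<^bsub>B\<^esub> h y) \<and>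
     (\<forall>c. \<forall>x\<in>carrier A. h (c \<odot>\<^bsub>A\<^esub> x) = c \<odot>\<^bsub>B\<^esub> h x)}"

section \<open>The Leavitt path algebra\<close>

text \<open>The defining relations, for elements \<open>p v\<close>, \<open>s e\<close>, \<open>t e\<close> (for \<open>v\<close>, \<open>e\<close>, \<open>e\<^sup>*\<close>) of \<open>A\<close>.\<close>

definition leavitt_family ::
  "('v, 'e) pre_digraph \<Rightarrow> ('k::field, 'a) module \<Rightarrow> ('v \<Rightarrow> 'a) \<Rightarrow> ('e \<Rightarrow> 'a) \<Rightarrow> ('e \<Rightarrow> 'a) \<Rightarrow> bool" where
  "leavitt_family E A p s t \<longleftrightarrow>
     (\<forall>v\<in>verts E. p v \<in> carrier A) \<and> (\<forall>e\<in>arcs E. s e \<in> carrier A \<and> t e \<in> carrier A) \<and>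
     (\<forall>v\<in>verts E. \<forall>w\<in>verts E. p v \<otimes>\<^bsub>A\<^esub> p w = (if v = w then p v else \<zero>\<^bsub>A\<^esub>)) \<and>
     (\<forall>e\<in>arcs E. p (tail E e) \<otimes>\<^bsub>A\<^esub> s e = s e \<and> s e \<otimes>\<^bsub>A\<^esub> p (head E e) = s e) \<and>
     (\<forall>e\<in>arcs E. p (head E e) \<otimes>\<^bsub>A\<^esub> t e = t e \<and> t e \<otimes>\<^bsub>A\<^esub> p (tail E e) = t e) \<and>
     (\<forall>e\<in>arcs E. \<forall>f\<in>arcs E. t e \<otimes>\<^bsub>A\<^esub> s f = (if e = f then p (head E e) else \<zero>\<^bsub>A\<^esub>)) \<and>
     (\<forall>v\<in>verts E. finite (out_arcs E v) \<and> out_arcs E v \<noteq> {} \<longrightarrow>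
        p v = (\<Oplus>\<^bsub>A\<^esub>e\<in>out_arcs E v. s e \<otimes>\<^bsub>A\<^esub> t e))"

text \<open>
  The universal algebra with these generators and relations is built in one step, as the algebra
  of terms in the generators modulo the congruence generated by the algebra axioms and the
  defining relations. Its universal property is the theorem \<open>leavitt_universal\<close> below.
\<close>

datatype ('k, 'v, 'e) lterm =
    Vertex 'v
  | Edge 'e
  | Ghost 'e
  | Zero
  | Plus "('k, 'v, 'e) lterm" "('k, 'v, 'e) lterm"
  | Times "('k, 'v, 'e) lterm" "('k, 'v, 'e) lterm"
  | Scale 'k "('k, 'v, 'e) lterm"

primrec term_over :: "('v, 'e) pre_digraph \<Rightarrow> ('k, 'v, 'e) lterm \<Rightarrow> bool" where
  "term_over E (Vertex v) \<longleftrightarrow> v \<in> verts E"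
| "term_over E (Edge e) \<longleftrightarrow> e \<in> arcs E"
| "term_over E (Ghost e) \<longleftrightarrow> e \<in> arcs E"
| "term_over E Zero \<longleftrightarrow> True"
| "term_over E (Plus x y) \<longleftrightarrow> term_over E x \<and> term_over E y"
| "term_over E (Times x y) \<longleftrightarrow> term_over E x \<and> term_over E y"
| "term_over E (Scale c x) \<longleftrightarrow> term_over E x"

definition term_sum :: "('k, 'v, 'e) lterm list \<Rightarrow> ('k, 'v, 'e) lterm" where
  "term_sum xs = foldr Plus xs Zero"

inductive leavitt_law ::
  "('v, 'e) pre_digraph \<Rightarrow> ('k::field, 'v, 'e) lterm \<Rightarrow> ('k, 'v, 'e) lterm \<Rightarrow> bool" for E where
  "leavitt_law E (Plus (Plus x y) z) (Plus x (Plus y z))"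
| "leavitt_law E (Plus x y) (Plus y x)"
| "leavitt_law E (Plus Zero x) x"
| "leavitt_law E (Plus (Scale (- 1) x) x) Zero"
| "leavitt_law E (Times (Times x y) z) (Times x (Times y z))"
| "leavitt_law E (Times (Plus x y) z) (Plus (Times x z) (Times y z))"
| "leavitt_law E (Times z (Plus x y)) (Plus (Times z x) (Times z y))"
| "leavitt_law E (Scale (c + d) x) (Plus (Scale c x) (Scale d x))"
| "leavitt_law E (Scale c (Plus x y)) (Plus (Scale c x) (Scale c y))"
| "leavitt_law E (Scale (c * d) x) (Scale c (Scale d x))"
| "leavitt_law E (Scale 1 x) x"
| "leavitt_law E (Times (Scale c x) y) (Scale c (Times x y))"
| "leavitt_law E (Times x (Scale c y)) (Scale c (Times x y))"
| "leavitt_law E (Times (Vertex v) (Vertex w)) (if v = w then Vertex v else Zero)"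
| "leavitt_law E (Times (Vertex (tail E e)) (Edge e)) (Edge e)"
| "leavitt_law E (Times (Edge e) (Vertex (head E e))) (Edge e)"
| "leavitt_law E (Times (Vertex (head E e)) (Ghost e)) (Ghost e)"
| "leavitt_law E (Times (Ghost e) (Vertex (tail E e))) (Ghost e)"
| "leavitt_law E (Times (Ghost e) (Edge f)) (if e = f then Vertex (head E e) else Zero)"
| "distinct es \<Longrightarrow> es \<noteq> [] \<Longrightarrow> set es = out_arcs E v \<Longrightarrow>
     leavitt_law E (Vertex v) (term_sum (map (\<lambda>e. Times (Edge e) (Ghost e)) es))"

inductive leavitt_eq ::
  "('v, 'e) pre_digraph \<Rightarrow> ('k::field, 'v, 'e) lterm \<Rightarrow> ('k, 'v, 'e) lterm \<Rightarrow> bool" for E where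
  law: "leavitt_law E x y \<Longrightarrow> term_over E x \<Longrightarrow> term_over E y \<Longrightarrow> leavitt_eq E x y"
| refl: "term_over E x \<Longrightarrow> leavitt_eq E x x"
| sym: "leavitt_eq E x y \<Longrightarrow> leavitt_eq E y x"
| trans: "leavitt_eq E x y \<Longrightarrow> leavitt_eq E y z \<Longrightarrow> leavitt_eq E x z"
| plus: "leavitt_eq E x x' \<Longrightarrow> leavitt_eq E y y' \<Longrightarrow> leavitt_eq E (Plus x y) (Plus x' y')"
| times: "leavitt_eq E x x' \<Longrightarrow> leavitt_eq E y y' \<Longrightarrow> leavitt_eq E (Times x y) (Times x' y')"
| scale: "leavitt_eq E x x' \<Longrightarrow> leavitt_eq E (Scale c x) (Scale c x')"

definition leavitt_class ::
  "('v, 'e) pre_digraph \<Rightarrow> ('k::field, 'v, 'e) lterm \<Rightarrow> ('k, 'v, 'e) lterm set" where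
  "leavitt_class E x = {y. leavitt_eq E x y}"

definition leavitt_algebra ::
  "('v, 'e) pre_digraph \<Rightarrow> ('k::field, ('k, 'v, 'e) lterm set) module" where
  "leavitt_algebra E =
     \<lparr> carrier = leavitt_class E ` {x. term_over E x},
       mult = (\<lambda>A B. \<Union>x\<in>A. \<Union>y\<in>B. leavitt_class E (Times x y)),
       one = undefined,
       zero = leavitt_class E Zero,
       add = (\<lambda>A B. \<Union>x\<in>A. \<Union>y\<in>B. leavitt_class E (Plus x y)),
       smult = (\<lambda>c A. \<Union>x\<in>A. leavitt_class E (Scale c x)) \<rparr>"

lemma leavitt_eq_over: "leavitt_eq E x y \<Longrightarrow> term_over E x \<and> term_over E y"
  by (induction rule: leavitt_eq.induct) auto

lemma leavitt_class_eq_iff: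
  "term_over E x \<Longrightarrow> leavitt_class E x = leavitt_class E y \<longleftrightarrow> leavitt_eq E x y"
  unfolding leavitt_class_def
  by (auto intro: leavitt_eq.refl leavitt_eq.sym leavitt_eq.trans)

lemma leavitt_class_self: "term_over E x \<Longrightarrow> x \<in> leavitt_class E x"
  by (simp add: leavitt_class_def leavitt_eq.refl)

lemma leavitt_class_lift:
  assumes "term_over E x" "term_over E y"
    and "\<And>x' y'. leavitt_eq E x x' \<Longrightarrow> leavitt_eq E y y' \<Longrightarrow> leavitt_eq E (g x y) (g x' y')"
  shows "(\<Union>x'\<in>leavitt_class E x. \<Union>y'\<in>leavitt_class E y. leavitt_class E (g x' y'))
           = leavitt_class E (g x y)"
proof -
  have "leavitt_class E (g x' y') = leavitt_class E (g x y)"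
    if "x' \<in> leavitt_class E x" "y' \<in> leavitt_class E y" for x' y'
    using that assms(3)[of x' y']
    by (metis leavitt_class_def mem_Collect_eq leavitt_class_eq_iff leavitt_eq_over)
  moreover have "x \<in> leavitt_class E x" "y \<in> leavitt_class E y"
    using assms by (auto intro: leavitt_class_self)
  ultimately show ?thesis by blast
qed

lemma leavitt_carrier [simp]:
  "carrier (leavitt_algebra E) = leavitt_class E ` {x. term_over E x}"
  by (simp add: leavitt_algebra_def)

lemma leavitt_zero [simp]: "\<zero>\<^bsub>leavitt_algebra E\<^esub> = leavitt_class E Zero"
  by (simp add: leavitt_algebra_def)

lemma leavitt_add [simp]:
  assumes "term_over E x" "term_over E y"
  shows "leavitt_class E x \<oplus>\<^bsub>leavitt_algebra E\<^esub> leavitt_class E y = leavitt_class E (Plus x y)"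
  using leavitt_class_lift[of E x y Plus] assms
  by (simp add: leavitt_algebra_def leavitt_eq.plus)

lemma leavitt_mult [simp]:
  assumes "term_over E x" "term_over E y"
  shows "leavitt_class E x \<otimes>\<^bsub>leavitt_algebra E\<^esub> leavitt_class E y = leavitt_class E (Times x y)"
  using leavitt_class_lift[of E x y Times] assms
  by (simp add: leavitt_algebra_def leavitt_eq.times)

lemma leavitt_smult [simp]:
  assumes "term_over E x"
  shows "c \<odot>\<^bsub>leavitt_algebra E\<^esub> leavitt_class E x = leavitt_class E (Scale c x)"
proof -
  have "(\<Union>x'\<in>leavitt_class E x. leavitt_class E (Scale c x'))
      = (\<Union>x'\<in>leavitt_class E x. \<Union>y'\<in>leavitt_class E x. leavitt_class E (Scale c x'))"
    using leavitt_class_self[OF assms] by blast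
  also have "\<dots> = leavitt_class E (Scale c x)"
    using assms by (rule leavitt_class_lift[of E x x "\<lambda>x _. Scale c x"]) (simp_all add: assms leavitt_eq.scale)
  finally show ?thesis by (simp add: leavitt_algebra_def)
qed

lemma leavitt_class_law:
  "leavitt_law E x y \<Longrightarrow> term_over E x \<Longrightarrow> term_over E y \<Longrightarrow> leavitt_class E x = leavitt_class E y"
  by (simp add: leavitt_class_eq_iff leavitt_eq.law)

lemmas leavitt_class_laws = leavitt_law.intros[THEN leavitt_class_law]

theorem leavitt_field_algebra: "field_algebra (leavitt_algebra E)"
proof -
  let ?L = "leavitt_algebra E"
  have "abelian_group ?L"
  proof (rule abelian_groupI)
    fix x assume "x \<in> carrier ?L"
    then obtain a where a: "term_over E a" "x = leavitt_class E a" by auto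
    then have "leavitt_class E (Scale (- 1) a) \<in> carrier ?L"
      "leavitt_class E (Scale (- 1) a) \<oplus>\<^bsub>?L\<^esub> x = \<zero>\<^bsub>?L\<^esub>"
      by (auto simp: leavitt_class_laws(4-13,15-18))
    then show "\<exists>y\<in>carrier ?L. y \<oplus>\<^bsub>?L\<^esub> x = \<zero>\<^bsub>?L\<^esub>" by blast
  qed (force simp: leavitt_class_laws(1,3) | force simp: leavitt_class_laws(2))+
  moreover have "field_algebra_axioms ?L"
    by unfold_locales (auto simp: leavitt_class_laws(4-13,15-18))
  ultimately show ?thesis by (rule field_algebra.intro)
qed

abbreviation leavitt_vertex :: "('v, 'e) pre_digraph \<Rightarrow> 'v \<Rightarrow> ('k::field, 'v, 'e) lterm set" where
  "leavitt_vertex E v \<equiv> leavitt_class E (Vertex v)"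

abbreviation leavitt_edge :: "('v, 'e) pre_digraph \<Rightarrow> 'e \<Rightarrow> ('k::field, 'v, 'e) lterm set" where
  "leavitt_edge E e \<equiv> leavitt_class E (Edge e)"

abbreviation leavitt_ghost :: "('v, 'e) pre_digraph \<Rightarrow> 'e \<Rightarrow> ('k::field, 'v, 'e) lterm set" where
  "leavitt_ghost E e \<equiv> leavitt_class E (Ghost e)"

lemma term_over_sum: "term_over E (term_sum xs) \<longleftrightarrow> (\<forall>x\<in>set xs. term_over E x)"
  by (induction xs) (auto simp: term_sum_def)

lemma leavitt_class_sum:
  assumes "distinct es" "set es \<subseteq> arcs E"
  shows "(\<Oplus>\<^bsub>leavitt_algebra E\<^esub>e\<in>set es. leavitt_edge E e \<otimes>\<^bsub>leavitt_algebra E\<^esub> leavitt_ghost E e)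
    = (leavitt_class E (term_sum (map (\<lambda>e. Times (Edge e) (Ghost e)) es)) :: ('k::field, 'v, 'e) lterm set)"
  using assms
proof (induction es)
  interpret field_algebra "leavitt_algebra E :: ('k, ('k, 'v, 'e) lterm set) module"
    by (rule leavitt_field_algebra)
  case Nil
  then show ?case by (simp add: term_sum_def)
next
  interpret field_algebra "leavitt_algebra E :: ('k, ('k, 'v, 'e) lterm set) module"
    by (rule leavitt_field_algebra)
  case (Cons e es)
  have *: "leavitt_edge E f \<otimes>\<^bsub>leavitt_algebra E\<^esub> leavitt_ghost E f \<in> carrier (leavitt_algebra E :: ('k, ('k, 'v, 'e) lterm set) module)"
    if "f \<in> set (e # es)" for f
    using that Cons.prems by auto
  have "finsum (leavitt_algebra E) (\<lambda>e. leavitt_edge E e \<otimes>\<^bsub>leavitt_algebra E\<^esub> leavitt_ghost E e) (insert e (set es))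
     = leavitt_edge E e \<otimes>\<^bsub>leavitt_algebra E\<^esub> leavitt_ghost E e \<oplus>\<^bsub>leavitt_algebra E\<^esub>
       finsum (leavitt_algebra E) (\<lambda>e. leavitt_edge E e \<otimes>\<^bsub>leavitt_algebra E\<^esub> (leavitt_ghost E e :: ('k, 'v, 'e) lterm set)) (set es)"
    using Cons.prems * by (intro finsum_insert) (auto simp del: leavitt_carrier leavitt_mult)
  also have "\<dots> = leavitt_class E (Times (Edge e) (Ghost e)) \<oplus>\<^bsub>leavitt_algebra E\<^esub>
      leavitt_class E (term_sum (map (\<lambda>e. Times (Edge e) (Ghost e)) es))"
    using Cons by simp
  also have "\<dots> = leavitt_class E (Plus (Times (Edge e) (Ghost e)) (term_sum (map (\<lambda>e. Times (Edge e) (Ghost e)) es)))"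
    using Cons.prems by (intro leavitt_add) (auto simp: term_over_sum)
  finally show ?case by (simp add: term_sum_def)
qed

theorem leavitt_generators:
  assumes "wf_digraph E"
  shows "leavitt_family E (leavitt_algebra E) (leavitt_vertex E) (leavitt_edge E) (leavitt_ghost E)"
proof -
  interpret wf_digraph E by fact
  show ?thesis
    unfolding leavitt_family_def
  proof (intro conjI ballI impI)
    fix v assume v: "v \<in> verts E" and fin: "finite (out_arcs E v) \<and> out_arcs E v \<noteq> {}"
    obtain es where es: "distinct es" "set es = out_arcs E v"
      using fin finite_distinct_list by metis
    have "leavitt_vertex E v = leavitt_class E (term_sum (map (\<lambda>e. Times (Edge e) (Ghost e)) es))"
      using es fin v by (intro leavitt_class_law leavitt_law.intros) (auto simp: term_over_sum)
    also have "\<dots> = (\<Oplus>\<^bsub>leavitt_algebra E\<^esub>e\<in>set es.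
        leavitt_edge E e \<otimes>\<^bsub>leavitt_algebra E\<^esub> leavitt_ghost E e)"
      using es by (intro leavitt_class_sum[symmetric]) auto
    finally show "leavitt_vertex E v = (\<Oplus>\<^bsub>leavitt_algebra E\<^esub>e\<in>out_arcs E v.
        leavitt_edge E e \<otimes>\<^bsub>leavitt_algebra E\<^esub> leavitt_ghost E e)"
      using es by simp
  next
    fix v w assume "v \<in> verts E" "w \<in> verts E"
    then show "leavitt_vertex E v \<otimes>\<^bsub>leavitt_algebra E\<^esub> leavitt_vertex E w =
      (if v = w then leavitt_vertex E v else \<zero>\<^bsub>leavitt_algebra E\<^esub>)"
      using leavitt_class_law[OF leavitt_law.intros(14)[of E v w]] by auto
  next
    fix e f assume "e \<in> arcs E" "f \<in> arcs E"
    then show "leavitt_ghost E e \<otimes>\<^bsub>leavitt_algebra E\<^esub> leavitt_edge E f =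
      (if e = f then leavitt_vertex E (head E e) else \<zero>\<^bsub>leavitt_algebra E\<^esub>)"
      using leavitt_class_law[OF leavitt_law.intros(19)[of E e f]] by auto
  qed (auto simp: leavitt_class_laws(4-13,15-18))
qed

primrec term_value :: "('k::field, 'a) module \<Rightarrow> ('v \<Rightarrow> 'a) \<Rightarrow> ('e \<Rightarrow> 'a) \<Rightarrow> ('e \<Rightarrow> 'a)
    \<Rightarrow> ('k, 'v, 'e) lterm \<Rightarrow> 'a" where
  "term_value A p s t (Vertex v) = p v"
| "term_value A p s t (Edge e) = s e"
| "term_value A p s t (Ghost e) = t e"
| "term_value A p s t Zero = \<zero>\<^bsub>A\<^esub>"
| "term_value A p s t (Plus x y) = term_value A p s t x \<oplus>\<^bsub>A\<^esub> term_value A p s t y"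
| "term_value A p s t (Times x y) = term_value A p s t x \<otimes>\<^bsub>A\<^esub> term_value A p s t y"
| "term_value A p s t (Scale c x) = c \<odot>\<^bsub>A\<^esub> term_value A p s t x"

context field_algebra
begin

lemma smult_zero: "x \<in> carrier A \<Longrightarrow> 0 \<odot> x = \<zero>"
  using smult_l_distr[of x 0 0] smult_closed[of x 0] by (simp add: add.l_cancel_one)

lemma smult_minus: "x \<in> carrier A \<Longrightarrow> (- 1) \<odot> x \<oplus> x = \<zero>"
  using smult_l_distr[of x "- 1" 1] smult_zero[of x] smult_one[of x] by simp

lemma term_value_closed:
  "leavitt_family E A p s t \<Longrightarrow> term_over E x \<Longrightarrow> term_value A p s t x \<in> carrier A"
  by (induction x) (auto simp: leavitt_family_def mult_closed smult_closed)

lemma term_value_sum: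
  assumes "leavitt_family E A p s t" "distinct es" "set es \<subseteq> arcs E"
  shows "term_value A p s t (term_sum (map (\<lambda>e. Times (Edge e) (Ghost e)) es))
       = (\<Oplus>e\<in>set es. s e \<otimes> t e)"
  using assms(2,3)
proof (induction es)
  case (Cons e es)
  have "s f \<otimes> t f \<in> carrier A" if "f \<in> arcs E" for f
    using that assms(1) by (auto simp: leavitt_family_def mult_closed)
  then have "(\<Oplus>e\<in>insert e (set es). s e \<otimes> t e) = s e \<otimes> t e \<oplus> (\<Oplus>e\<in>set es. s e \<otimes> t e)"
    using Cons.prems by (intro finsum_insert) auto
  then show ?case using Cons by (simp add: term_sum_def)
qed (simp add: term_sum_def)

lemma term_value_law:
  assumes F: "leavitt_family E A p s t"
    and "leavitt_law E x y" "term_over E x" "term_over E y"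
  shows "term_value A p s t x = term_value A p s t y"
  using assms(2-4)
proof (cases rule: leavitt_law.cases)
  case (20 es v)
  have "finite (out_arcs E v)" "out_arcs E v \<noteq> {}" using 20 by (metis List.finite_set, metis set_empty)
  then have "p v = (\<Oplus>e\<in>out_arcs E v. s e \<otimes> t e)"
    using F assms(3) 20 by (simp add: leavitt_family_def)
  moreover have "set es \<subseteq> arcs E" using 20 by auto
  ultimately show ?thesis using term_value_sum[OF F, of es] 20 by simp
next
  case (2 x y)
  then show ?thesis using term_value_closed[OF F] assms(3) by (simp add: a_comm)
qed (use term_value_closed[OF F] F in \<open>auto simp: leavitt_family_def a_assoc mult_closed
      smult_closed mult_assoc l_distr r_distr smult_l_distr smult_r_distr smult_assoc1 smult_one
      smult_mult_l smult_mult_r smult_minus\<close>)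

lemma term_value_eq:
  assumes "leavitt_family E A p s t" "leavitt_eq E x y"
  shows "term_value A p s t x = term_value A p s t y"
  using assms(2) by (induction) (auto simp: term_value_law[OF assms(1)])

theorem leavitt_universal:
  fixes E :: "('v, 'e) pre_digraph"
  assumes F: "leavitt_family E A p s t"
  shows "\<exists>!h. h \<in> algebra_hom (leavitt_algebra E) A \<and> h \<in> extensional (carrier (leavitt_algebra E)) \<and>
      (\<forall>v\<in>verts E. h (leavitt_vertex E v) = p v) \<and>
      (\<forall>e\<in>arcs E. h (leavitt_edge E e) = s e \<and> h (leavitt_ghost E e) = t e)"
proof -
  let ?L = "leavitt_algebra E"
  define h where "h = restrict (\<lambda>B. term_value A p s t (SOME x. x \<in> B)) (carrier ?L)"
  have h: "h (leavitt_class E x) = term_value A p s t x" if "term_over E x" for x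
  proof -
    have "(SOME y. y \<in> leavitt_class E x) \<in> leavitt_class E x"
      using leavitt_class_self[OF that] by (rule someI)
    then have "term_value A p s t x = term_value A p s t (SOME y. y \<in> leavitt_class E x)"
      using term_value_eq[OF F] by (auto simp: leavitt_class_def)
    then show ?thesis using that by (auto simp: h_def)
  qed
  show ?thesis
  proof (rule ex1I[of _ h])
    have "h \<in> algebra_hom ?L A"
      unfolding algebra_hom_def using h term_value_closed[OF F] by auto
    moreover have "h \<in> extensional (carrier ?L)" unfolding h_def by (rule restrict_extensional)
    ultimately show "h \<in> algebra_hom ?L A \<and> h \<in> extensional (carrier ?L) \<and>
      (\<forall>v\<in>verts E. h (leavitt_vertex E v) = p v) \<and>
      (\<forall>e\<in>arcs E. h (leavitt_edge E e) = s e \<and> h (leavitt_ghost E e) = t e)"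
      using h by auto
  next
    fix g assume g: "g \<in> algebra_hom ?L A \<and> g \<in> extensional (carrier ?L) \<and>
      (\<forall>v\<in>verts E. g (leavitt_vertex E v) = p v) \<and>
      (\<forall>e\<in>arcs E. g (leavitt_edge E e) = s e \<and> g (leavitt_ghost E e) = t e)"
    have add: "g (leavitt_class E (Plus x y)) = g (leavitt_class E x) \<oplus> g (leavitt_class E y)"
      and mult: "g (leavitt_class E (Times x y)) = g (leavitt_class E x) \<otimes> g (leavitt_class E y)"
      and smult: "g (leavitt_class E (Scale c x)) = c \<odot> g (leavitt_class E x)"
      if "term_over E x" "term_over E y" for x y c
      using g that unfolding algebra_hom_def
      by (auto simp flip: leavitt_add leavitt_mult leavitt_smult)
    have cl: "g (leavitt_class E x) \<in> carrier A" if "term_over E x" for x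
      using g that unfolding algebra_hom_def by auto
    have z: "g (leavitt_class E Zero) = \<zero>"
    proof -
      have "leavitt_class E (Plus Zero Zero) = leavitt_class E Zero"
        by (intro leavitt_class_law leavitt_law.intros) auto
      then have "g (leavitt_class E Zero) = g (leavitt_class E Zero) \<oplus> g (leavitt_class E Zero)"
        using add[of Zero Zero] by (metis term_over.simps(4))
      then show ?thesis using cl[of Zero] by (metis add.l_cancel_one' term_over.simps(4))
    qed
    have eq: "g (leavitt_class E x) = term_value A p s t x" if "term_over E x" for x
      using that by (induction x) (use g in \<open>auto simp: add mult smult z\<close>)
    show "g = h"
    proof (rule extensionalityI[of _ "carrier ?L"])
      show "h \<in> extensional (carrier ?L)" unfolding h_def by (rule restrict_extensional)
      fix B :: "('k, 'v, 'e) lterm set" assume "B \<in> carrier ?L"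
      then show "g B = h B" using eq h by auto
    qed (use g in auto)
  qed
qed

end

section \<open>Algebraic branching systems and the induced representation\<close>

definition algebraic_branching_system ::
  "('v, 'e) pre_digraph \<Rightarrow> 'x set \<Rightarrow> ('e \<Rightarrow> 'x set) \<Rightarrow> ('v \<Rightarrow> 'x set) \<Rightarrow> ('e \<Rightarrow> 'x \<Rightarrow> 'x) \<Rightarrow> bool" where
  "algebraic_branching_system E X R D f \<longleftrightarrow>
     (\<forall>e\<in>arcs E. R e \<subseteq> X) \<and> (\<forall>v\<in>verts E. D v \<subseteq> X) \<and>
     disjoint_family_on R (arcs E) \<and> disjoint_family_on D (verts E) \<and>
     (\<forall>e\<in>arcs E. R e \<subseteq> D (tail E e)) \<and>
     (\<forall>v\<in>verts E. finite (out_arcs E v) \<and> out_arcs E v \<noteq> {} \<longrightarrow> D v = (\<Union>e\<in>out_arcs E v. R e)) \<and>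
     (\<forall>e\<in>arcs E. bij_betw (f e) (D (head E e)) (R e))"

text \<open>
  Functions on \<open>X\<close>, and maps on such functions, are represented by extensional functions
  (\<^term>\<open>X \<rightarrow>\<^sub>E Y\<close>), so that equality in the algebra of linear maps is equality of maps.
\<close>

definition fun_module :: "'x set \<Rightarrow> ('x \<Rightarrow> 'k) set" where
  "fun_module X = X \<rightarrow>\<^sub>E UNIV"

definition fun_add :: "'x set \<Rightarrow> ('x \<Rightarrow> 'k::field) \<Rightarrow> ('x \<Rightarrow> 'k) \<Rightarrow> 'x \<Rightarrow> 'k" where
  "fun_add X \<phi> \<psi> = (\<lambda>x\<in>X. \<phi> x + \<psi> x)"

definition fun_scale :: "'x set \<Rightarrow> 'k::field \<Rightarrow> ('x \<Rightarrow> 'k) \<Rightarrow> 'x \<Rightarrow> 'k" where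
  "fun_scale X c \<phi> = (\<lambda>x\<in>X. c * \<phi> x)"

definition end_algebra :: "'x set \<Rightarrow> ('k::field, ('x \<Rightarrow> 'k) \<Rightarrow> ('x \<Rightarrow> 'k)) module" where
  "end_algebra X =
     \<lparr> carrier = {T \<in> fun_module X \<rightarrow>\<^sub>E fun_module X.
         (\<forall>\<phi>\<in>fun_module X. \<forall>\<psi>\<in>fun_module X. T (fun_add X \<phi> \<psi>) = fun_add X (T \<phi>) (T \<psi>)) \<and>
         (\<forall>c. \<forall>\<phi>\<in>fun_module X. T (fun_scale X c \<phi>) = fun_scale X c (T \<phi>))},
       mult = (\<lambda>S T. compose (fun_module X) S T),
       one = (\<lambda>\<phi>\<in>fun_module X. \<phi>),
       zero = (\<lambda>\<phi>\<in>fun_module X. \<lambda>x\<in>X. 0),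
       add = (\<lambda>S T. \<lambda>\<phi>\<in>fun_module X. fun_add X (S \<phi>) (T \<phi>)),
       smult = (\<lambda>c T. \<lambda>\<phi>\<in>fun_module X. fun_scale X c (T \<phi>)) \<rparr>"

definition rep_edge ::
  "('v, 'e) pre_digraph \<Rightarrow> 'x set \<Rightarrow> ('e \<Rightarrow> 'x set) \<Rightarrow> ('v \<Rightarrow> 'x set) \<Rightarrow> ('e \<Rightarrow> 'x \<Rightarrow> 'x)
     \<Rightarrow> 'e \<Rightarrow> ('x \<Rightarrow> 'k::field) \<Rightarrow> ('x \<Rightarrow> 'k)" where
  "rep_edge E X R D f e =
     (\<lambda>\<phi>\<in>fun_module X. \<lambda>x\<in>X. if x \<in> R e then \<phi> (inv_into (D (head E e)) (f e) x) else 0)"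

definition rep_ghost ::
  "('v, 'e) pre_digraph \<Rightarrow> 'x set \<Rightarrow> ('v \<Rightarrow> 'x set) \<Rightarrow> ('e \<Rightarrow> 'x \<Rightarrow> 'x)
     \<Rightarrow> 'e \<Rightarrow> ('x \<Rightarrow> 'k::field) \<Rightarrow> ('x \<Rightarrow> 'k)" where
  "rep_ghost E X D f e =
     (\<lambda>\<phi>\<in>fun_module X. \<lambda>x\<in>X. if x \<in> D (head E e) then \<phi> (f e x) else 0)"

definition rep_vertex :: "'x set \<Rightarrow> ('v \<Rightarrow> 'x set) \<Rightarrow> 'v \<Rightarrow> ('x \<Rightarrow> 'k::field) \<Rightarrow> ('x \<Rightarrow> 'k)" where
  "rep_vertex X D v = (\<lambda>\<phi>\<in>fun_module X. \<lambda>x\<in>X. if x \<in> D v then \<phi> x else 0)"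

text \<open>
  The homomorphism determined by the values on the generators; it exists and is unique for every
  algebraic branching system, by \<open>induced_rep_unique\<close>.
\<close>

definition induced_rep ::
  "('v, 'e) pre_digraph \<Rightarrow> 'x set \<Rightarrow> ('e \<Rightarrow> 'x set) \<Rightarrow> ('v \<Rightarrow> 'x set) \<Rightarrow> ('e \<Rightarrow> 'x \<Rightarrow> 'x)
     \<Rightarrow> ('k::field, 'v, 'e) lterm set \<Rightarrow> ('x \<Rightarrow> 'k) \<Rightarrow> ('x \<Rightarrow> 'k)" where
  "induced_rep E X R D f = (THE \<pi>.
     \<pi> \<in> algebra_hom (leavitt_algebra E) (end_algebra X) \<and>
     \<pi> \<in> extensional (carrier (leavitt_algebra E)) \<and>
     (\<forall>v\<in>verts E. \<pi> (leavitt_vertex E v) = rep_vertex X D v) \<and>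
     (\<forall>e\<in>arcs E. \<pi> (leavitt_edge E e) = rep_edge E X R D f e \<and>
                   \<pi> (leavitt_ghost E e) = rep_ghost E X D f e))"

lemma fun_add_in [simp]: "fun_add X \<phi> \<psi> \<in> fun_module X"
  by (simp add: fun_add_def fun_module_def)

lemma fun_scale_in [simp]: "fun_scale X c \<phi> \<in> fun_module X"
  by (simp add: fun_scale_def fun_module_def)

lemma fun_restrict_in [simp]: "(\<lambda>x\<in>X. g x) \<in> fun_module X"
  by (simp add: fun_module_def)

lemma end_eqI:
  assumes "S \<in> extensional (fun_module X)" "T \<in> extensional (fun_module X)"
    and "\<And>\<phi>. \<phi> \<in> fun_module X \<Longrightarrow> S \<phi> \<in> fun_module X"
    and "\<And>\<phi>. \<phi> \<in> fun_module X \<Longrightarrow> T \<phi> \<in> fun_module X"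
    and "\<And>\<phi> x. \<phi> \<in> fun_module X \<Longrightarrow> x \<in> X \<Longrightarrow> S \<phi> x = T \<phi> x"
  shows "S = T"
proof (rule extensionalityI[OF assms(1,2)])
  fix \<phi> :: "'a \<Rightarrow> 'b" assume "\<phi> \<in> fun_module X"
  then show "S \<phi> = T \<phi>"
    using assms(3-5)[of \<phi>] by (intro extensionalityI[of _ X]) (auto simp: fun_module_def PiE_def)
qed

lemma end_algebra_carrierD:
  assumes "T \<in> carrier (end_algebra X)"
  shows "T \<in> extensional (fun_module X)"
    and "\<phi> \<in> fun_module X \<Longrightarrow> T \<phi> \<in> fun_module X"
    and "\<phi> \<in> fun_module X \<Longrightarrow> \<psi> \<in> fun_module X \<Longrightarrow> T (fun_add X \<phi> \<psi>) = fun_add X (T \<phi>) (T \<psi>)"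
    and "\<phi> \<in> fun_module X \<Longrightarrow> T (fun_scale X c \<phi>) = fun_scale X c (T \<phi>)"
  using assms by (auto simp: end_algebra_def PiE_def)

lemma end_algebra_carrierI:
  assumes "T \<in> extensional (fun_module X)"
    and "\<And>\<phi>. \<phi> \<in> fun_module X \<Longrightarrow> T \<phi> \<in> fun_module X"
    and "\<And>\<phi> \<psi> x. \<phi> \<in> fun_module X \<Longrightarrow> \<psi> \<in> fun_module X \<Longrightarrow> x \<in> X \<Longrightarrow>
           T (fun_add X \<phi> \<psi>) x = T \<phi> x + T \<psi> x"
    and "\<And>c \<phi> x. \<phi> \<in> fun_module X \<Longrightarrow> x \<in> X \<Longrightarrow> T (fun_scale X c \<phi>) x = c * T \<phi> x"
  shows "T \<in> carrier (end_algebra X)"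
proof -
  have "T (fun_add X \<phi> \<psi>) = fun_add X (T \<phi>) (T \<psi>)" if "\<phi> \<in> fun_module X" "\<psi> \<in> fun_module X" for \<phi> \<psi>
    using assms(2)[of "fun_add X \<phi> \<psi>"] assms(3)[OF that]
    by (intro extensionalityI[of _ X]) (auto simp: fun_module_def fun_add_def PiE_def)
  moreover have "T (fun_scale X c \<phi>) = fun_scale X c (T \<phi>)" if "\<phi> \<in> fun_module X" for \<phi> c
    using assms(2)[of "fun_scale X c \<phi>"] assms(4)[OF that]
    by (intro extensionalityI[of _ X]) (auto simp: fun_module_def fun_scale_def PiE_def)
  ultimately show ?thesis using assms(1,2) by (auto simp: end_algebra_def PiE_def)
qed

lemma end_algebra_simps:
  "S \<otimes>\<^bsub>end_algebra X\<^esub> T = compose (fun_module X) S T"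
  "\<zero>\<^bsub>end_algebra X\<^esub> = (\<lambda>\<phi>\<in>fun_module X. \<lambda>x\<in>X. 0)"
  "S \<oplus>\<^bsub>end_algebra X\<^esub> T = (\<lambda>\<phi>\<in>fun_module X. fun_add X (S \<phi>) (T \<phi>))"
  "c \<odot>\<^bsub>end_algebra X\<^esub> T = (\<lambda>\<phi>\<in>fun_module X. fun_scale X c (T \<phi>))"
  by (simp_all add: end_algebra_def)

theorem end_field_algebra:
  fixes X :: "'x set"
  shows "field_algebra (end_algebra X :: ('k::field, ('x \<Rightarrow> 'k) \<Rightarrow> ('x \<Rightarrow> 'k)) module)"
proof -
  let ?H = "end_algebra X :: ('k, ('x \<Rightarrow> 'k) \<Rightarrow> ('x \<Rightarrow> 'k)) module"
  note [simp] = end_algebra_simps compose_def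
  note D = end_algebra_carrierD
  have add: "S \<oplus>\<^bsub>?H\<^esub> T \<in> carrier ?H" if "S \<in> carrier ?H" "T \<in> carrier ?H" for S T
    using D[OF that(1)] D[OF that(2)]
    by (intro end_algebra_carrierI) (auto simp: fun_add_def[of X "S _"] fun_scale_def[of X _ "S _"]
      fun_add_def[of X "T _"] fun_scale_def[of X _ "T _"] algebra_simps)
  have scale: "c \<odot>\<^bsub>?H\<^esub> T \<in> carrier ?H" if "T \<in> carrier ?H" for c T
    using D[OF that]
    by (intro end_algebra_carrierI) (auto simp: fun_add_def[of X "T _"] fun_scale_def[of X _ "T _"] algebra_simps)
  have zero: "\<zero>\<^bsub>?H\<^esub> \<in> carrier ?H"
    by (intro end_algebra_carrierI) auto
  have mult: "S \<otimes>\<^bsub>?H\<^esub> T \<in> carrier ?H" if "S \<in> carrier ?H" "T \<in> carrier ?H" for S T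
    using D[OF that(1)] D[OF that(2)]
    by (intro end_algebra_carrierI) (auto simp: fun_add_def[of X "S _"] fun_scale_def[of X _ "S _"])
  have "abelian_group ?H"
  proof (rule abelian_groupI)
    fix T assume T: "T \<in> carrier ?H"
    have "(- 1) \<odot>\<^bsub>?H\<^esub> T \<oplus>\<^bsub>?H\<^esub> T = \<zero>\<^bsub>?H\<^esub>"
      using D[OF T] by (intro end_eqI[of _ X]) (auto simp: fun_add_def fun_scale_def)
    then show "\<exists>S\<in>carrier ?H. S \<oplus>\<^bsub>?H\<^esub> T = \<zero>\<^bsub>?H\<^esub>" using scale[OF T] by blast
  next
    fix S T U assume "S \<in> carrier ?H" "T \<in> carrier ?H" "U \<in> carrier ?H"
    then show "S \<oplus>\<^bsub>?H\<^esub> T \<oplus>\<^bsub>?H\<^esub> U = S \<oplus>\<^bsub>?H\<^esub> (T \<oplus>\<^bsub>?H\<^esub> U)"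
      by (intro end_eqI[of _ X]) (auto simp: fun_add_def add.assoc)
  next
    fix S T assume "S \<in> carrier ?H" "T \<in> carrier ?H"
    then show "S \<oplus>\<^bsub>?H\<^esub> T = T \<oplus>\<^bsub>?H\<^esub> S"
      by (intro end_eqI[of _ X]) (auto simp: fun_add_def add.commute)
  next
    fix T assume T: "T \<in> carrier ?H"
    show "\<zero>\<^bsub>?H\<^esub> \<oplus>\<^bsub>?H\<^esub> T = T"
      using D[OF T] by (intro end_eqI[of _ X]) (auto simp: fun_add_def)
  qed (use add zero in blast)+
  moreover have "field_algebra_axioms ?H"
  proof
    fix S T U :: "('x \<Rightarrow> 'k) \<Rightarrow> ('x \<Rightarrow> 'k)" and c d :: 'k
    assume S: "S \<in> carrier ?H"
    note DS = D[OF S]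
    show "c \<odot>\<^bsub>?H\<^esub> S \<in> carrier ?H" using S by (rule scale)
    show "(c + d) \<odot>\<^bsub>?H\<^esub> S = c \<odot>\<^bsub>?H\<^esub> S \<oplus>\<^bsub>?H\<^esub> d \<odot>\<^bsub>?H\<^esub> S"
      by (rule end_eqI[of _ X]) (auto simp: fun_add_def fun_scale_def algebra_simps)
    show "(c * d) \<odot>\<^bsub>?H\<^esub> S = c \<odot>\<^bsub>?H\<^esub> (d \<odot>\<^bsub>?H\<^esub> S)"
      by (rule end_eqI[of _ X]) (auto simp: fun_scale_def)
    show "1 \<odot>\<^bsub>?H\<^esub> S = S"
      using DS by (intro end_eqI[of _ X]) (auto simp: fun_scale_def)
    assume T: "T \<in> carrier ?H"
    note DT = D[OF T]
    show "S \<otimes>\<^bsub>?H\<^esub> T \<in> carrier ?H" using S T by (rule mult)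
    show "c \<odot>\<^bsub>?H\<^esub> (S \<oplus>\<^bsub>?H\<^esub> T) = c \<odot>\<^bsub>?H\<^esub> S \<oplus>\<^bsub>?H\<^esub> c \<odot>\<^bsub>?H\<^esub> T"
      by (rule end_eqI[of _ X]) (auto simp: fun_add_def fun_scale_def algebra_simps)
    show "(c \<odot>\<^bsub>?H\<^esub> S) \<otimes>\<^bsub>?H\<^esub> T = c \<odot>\<^bsub>?H\<^esub> (S \<otimes>\<^bsub>?H\<^esub> T)"
      using DT by (intro end_eqI[of _ X]) auto
    show "S \<otimes>\<^bsub>?H\<^esub> (c \<odot>\<^bsub>?H\<^esub> T) = c \<odot>\<^bsub>?H\<^esub> (S \<otimes>\<^bsub>?H\<^esub> T)"
      using DS DT by (intro end_eqI[of _ X]) auto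
    assume U: "U \<in> carrier ?H"
    note DU = D[OF U]
    show "(S \<otimes>\<^bsub>?H\<^esub> T) \<otimes>\<^bsub>?H\<^esub> U = S \<otimes>\<^bsub>?H\<^esub> (T \<otimes>\<^bsub>?H\<^esub> U)"
      using DS DT DU by (intro end_eqI[of _ X]) auto
    show "(S \<oplus>\<^bsub>?H\<^esub> T) \<otimes>\<^bsub>?H\<^esub> U = S \<otimes>\<^bsub>?H\<^esub> U \<oplus>\<^bsub>?H\<^esub> T \<otimes>\<^bsub>?H\<^esub> U"
      using DS DT DU by (intro end_eqI[of _ X]) auto
    show "U \<otimes>\<^bsub>?H\<^esub> (S \<oplus>\<^bsub>?H\<^esub> T) = U \<otimes>\<^bsub>?H\<^esub> S \<oplus>\<^bsub>?H\<^esub> U \<otimes>\<^bsub>?H\<^esub> T"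
      using DS DT DU by (intro end_eqI[of _ X]) auto
  qed
  ultimately show ?thesis by (rule field_algebra.intro)
qed

lemma end_finsum:
  assumes "finite F" "T \<in> F \<rightarrow> carrier (end_algebra X)" "\<phi> \<in> fun_module X" "x \<in> X"
  shows "(\<Oplus>\<^bsub>end_algebra X\<^esub>i\<in>F. T i) \<phi> x = (\<Sum>i\<in>F. T i \<phi> x)"
  using assms(1,2)
proof (induction F)
  interpret field_algebra "end_algebra X" by (rule end_field_algebra)
  case empty
  then show ?case using assms by (simp add: end_algebra_simps)
next
  interpret field_algebra "end_algebra X" by (rule end_field_algebra)
  case (insert i F)
  then show ?case using assms by (simp add: end_algebra_simps fun_add_def Pi_iff)
qed

lemma branching_leavitt_family:
  fixes X :: "'x set"
  assumes E: "wf_digraph E" and B: "algebraic_branching_system E X R D f"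
  shows "leavitt_family E (end_algebra X :: ('k::field, ('x \<Rightarrow> 'k) \<Rightarrow> ('x \<Rightarrow> 'k)) module)
           (rep_vertex X D) (rep_edge E X R D f) (rep_ghost E X D f)"
proof -
  let ?H = "end_algebra X :: ('k, ('x \<Rightarrow> 'k) \<Rightarrow> ('x \<Rightarrow> 'k)) module"
  interpret wf_digraph E by fact
  interpret field_algebra "end_algebra X :: ('k, ('x \<Rightarrow> 'k) \<Rightarrow> ('x \<Rightarrow> 'k)) module" by (rule end_field_algebra)
  have RX: "R e \<subseteq> X" and RD: "R e \<subseteq> D (tail E e)" and bij: "bij_betw (f e) (D (head E e)) (R e)"
    if "e \<in> arcs E" for e
    using B that by (auto simp: algebraic_branching_system_def)
  have DX: "D v \<subseteq> X" if "v \<in> verts E" for v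
    using B that by (auto simp: algebraic_branching_system_def)
  have Rdisj: "e = e'" if "e \<in> arcs E" "e' \<in> arcs E" "x \<in> R e" "x \<in> R e'" for e e' x
  proof -
    have "disjoint_family_on R (arcs E)" using B by (simp add: algebraic_branching_system_def)
    then show ?thesis using that unfolding disjoint_family_on_def by blast
  qed
  have Ddisj: "v = w" if "v \<in> verts E" "w \<in> verts E" "x \<in> D v" "x \<in> D w" for v w x
  proof -
    have "disjoint_family_on D (verts E)" using B by (simp add: algebraic_branching_system_def)
    then show ?thesis using that unfolding disjoint_family_on_def by blast
  qed
  have DR: "D v = (\<Union>e\<in>out_arcs E v. R e)" if "v \<in> verts E" "finite (out_arcs E v)" "out_arcs E v \<noteq> {}" for v
    using B that by (auto simp: algebraic_branching_system_def)
  have fD: "f e x \<in> R e" "inv_into (D (head E e)) (f e) (f e x) = x" if "e \<in> arcs E" "x \<in> D (head E e)" for e x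
    using bij[OF that(1)] that(2) by (auto simp: bij_betw_def)
  have fR: "inv_into (D (head E e)) (f e) x \<in> D (head E e)" "f e (inv_into (D (head E e)) (f e) x) = x"
    if "e \<in> arcs E" "x \<in> R e" for e x
    using bij[OF that(1)] that(2) by (auto simp: bij_betw_def inv_into_into f_inv_into_f)
  have head: "D (head E e) \<subseteq> X" if "e \<in> arcs E" for e using that DX by simp
  note X = subsetD[OF RX] subsetD[OF head] subsetD[OF RD] subsetD[OF DX]
  have V: "rep_vertex X D v \<in> carrier ?H" if "v \<in> verts E" for v
    by (rule end_algebra_carrierI) (auto simp: rep_vertex_def fun_add_def fun_scale_def)
  have S: "rep_edge E X R D f e \<in> carrier ?H" if "e \<in> arcs E" for e
    using that by (intro end_algebra_carrierI) (auto simp: rep_edge_def fun_add_def fun_scale_def fR X)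
  have T: "rep_ghost E X D f e \<in> carrier ?H" if "e \<in> arcs E" for e
    using that by (intro end_algebra_carrierI) (auto simp: rep_ghost_def fun_add_def fun_scale_def fD X)
  have ext: "rep_vertex X D v \<in> extensional (fun_module X)" "rep_edge E X R D f e \<in> extensional (fun_module X)"
     "rep_ghost E X D f e \<in> extensional (fun_module X)" for v e
    by (simp_all add: rep_vertex_def rep_edge_def rep_ghost_def)
  have V': "rep_vertex X D v \<phi> = (\<lambda>x\<in>X. if x \<in> D v then \<phi> x else 0)"
    and S': "rep_edge E X R D f e \<phi> = (\<lambda>x\<in>X. if x \<in> R e then \<phi> (inv_into (D (head E e)) (f e) x) else 0)"
    and T': "rep_ghost E X D f e \<phi> = (\<lambda>x\<in>X. if x \<in> D (head E e) then \<phi> (f e x) else 0)"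
    if "\<phi> \<in> fun_module X" for \<phi> :: "'x \<Rightarrow> 'k" and v e
    using that by (simp_all add: rep_vertex_def rep_edge_def rep_ghost_def)
  note simps = V' S' T' end_algebra_simps compose_def ext
  show ?thesis
    unfolding leavitt_family_def
  proof (intro conjI ballI impI)
    fix v w assume "v \<in> verts E" "w \<in> verts E"
    then show "rep_vertex X D v \<otimes>\<^bsub>?H\<^esub> rep_vertex X D w =
        (if v = w then rep_vertex X D v else \<zero>\<^bsub>?H\<^esub>)"
      by (intro end_eqI[of _ X]) (auto simp: simps dest: Ddisj)
  next
    fix e f' assume "e \<in> arcs E" "f' \<in> arcs E"
    then show "rep_ghost E X D f e \<otimes>\<^bsub>?H\<^esub> rep_edge E X R D f f' =
        (if e = f' then rep_vertex X D (head E e) else \<zero>\<^bsub>?H\<^esub>)"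
      by (intro end_eqI[of _ X]) (auto simp: simps fD X dest: Rdisj[OF _ _ fD(1)])
  next
    fix v assume v: "v \<in> verts E" and fin: "finite (out_arcs E v) \<and> out_arcs E v \<noteq> {}"
    let ?g = "\<lambda>e. rep_edge E X R D f e \<otimes>\<^bsub>?H\<^esub> (rep_ghost E X D f e :: ('x \<Rightarrow> 'k) \<Rightarrow> _)"
    have cl: "?g \<in> out_arcs E v \<rightarrow> carrier ?H"
      using S T by (auto intro: mult_closed)
    show "rep_vertex X D v = (\<Oplus>\<^bsub>?H\<^esub>e\<in>out_arcs E v. ?g e)"
    proof (rule end_eqI[of _ X])
      fix \<phi> :: "'x \<Rightarrow> 'k" and x assume p: "\<phi> \<in> fun_module X" "x \<in> X"
      have g: "?g e \<phi> x = (if x \<in> R e then \<phi> x else 0)" if "e \<in> out_arcs E v" for e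
        using that p by (auto simp: simps fR X)
      have "(\<Sum>e\<in>out_arcs E v. ?g e \<phi> x) = (\<Sum>e\<in>out_arcs E v. if x \<in> R e then \<phi> x else 0)"
        by (intro sum.cong) (auto simp: g)
      also have "\<dots> = (if x \<in> D v then \<phi> x else 0)"
      proof (cases "x \<in> D v")
        case True
        then obtain e where e: "e \<in> out_arcs E v" "x \<in> R e" using DR v fin by blast
        have "(\<Sum>e\<in>out_arcs E v. if x \<in> R e then \<phi> x else 0) = (\<Sum>e'\<in>out_arcs E v. if e' = e then \<phi> x else 0)"
          using e by (intro sum.cong) (auto dest: Rdisj)
        then show ?thesis using True fin e by simp
      next
        case False
        then have "x \<notin> R e" if "e \<in> out_arcs E v" for e using DR v fin that by blast
        then show ?thesis using False by simp
      qed
      finally show "rep_vertex X D v \<phi> x = (\<Oplus>\<^bsub>?H\<^esub>e\<in>out_arcs E v. ?g e) \<phi> x"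
        using end_finsum[OF _ cl p] fin p by (simp add: V')
    qed (use V[OF v] finsum_closed[OF cl] in \<open>auto dest: end_algebra_carrierD\<close>)
  next
    fix e assume e: "e \<in> arcs E"
    show "rep_vertex X D (tail E e) \<otimes>\<^bsub>?H\<^esub> rep_edge E X R D f e = rep_edge E X R D f e"
      using e by (intro end_eqI[of _ X]) (auto simp: simps fR X)
    show "rep_edge E X R D f e \<otimes>\<^bsub>?H\<^esub> rep_vertex X D (head E e) = rep_edge E X R D f e"
      using e by (intro end_eqI[of _ X]) (auto simp: simps fR X)
    show "rep_vertex X D (head E e) \<otimes>\<^bsub>?H\<^esub> rep_ghost E X D f e = rep_ghost E X D f e"
      using e by (intro end_eqI[of _ X]) (auto simp: simps fD X)
    show "rep_ghost E X D f e \<otimes>\<^bsub>?H\<^esub> rep_vertex X D (tail E e) = rep_ghost E X D f e"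
      using e by (intro end_eqI[of _ X]) (auto simp: simps fD X)
  qed (use V S T in auto)
qed

theorem induced_rep_unique:
  assumes "wf_digraph E" and "algebraic_branching_system E X R D f"
  shows "\<exists>!\<pi>. \<pi> \<in> algebra_hom (leavitt_algebra E) (end_algebra X) \<and>
     \<pi> \<in> extensional (carrier (leavitt_algebra E)) \<and>
     (\<forall>v\<in>verts E. \<pi> (leavitt_vertex E v) = rep_vertex X D v) \<and>
     (\<forall>e\<in>arcs E. \<pi> (leavitt_edge E e) = rep_edge E X R D f e \<and>
                   \<pi> (leavitt_ghost E e) = rep_ghost E X D f e)"
  by (rule field_algebra.leavitt_universal[OF end_field_algebra branching_leavitt_family[OF assms]])

lemmas induced_rep_properties = theI'[OF induced_rep_unique, folded induced_rep_def]

section \<open>The branching system on intervals built from an irrational rotation\<close>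

text \<open>
  \<open>en\<close> enumerates the edges without repetition, \<open>en i\<close> being the \<open>i\<close>-th edge. The index set \<open>I\<close>
  is an initial segment of the positive integers or all of them.
\<close>

definition edge_enumeration :: "('v, 'e) pre_digraph \<Rightarrow> nat set \<Rightarrow> (nat \<Rightarrow> 'e) \<Rightarrow> bool" where
  "edge_enumeration E I en \<longleftrightarrow> (I = {1..} \<or> (\<exists>n. I = {1..n})) \<and> bij_betw en I (arcs E)"

text \<open>
  For each edge \<open>e\<close>, the function \<open>l e\<close> lists the edges with source \<open>head E e\<close>, in any order, as
  \<open>l e 1, \<dots>, l e P\<close>.
\<close>

definition successor_listing :: "('v, 'e) pre_digraph \<Rightarrow> ('e \<Rightarrow> nat \<Rightarrow> 'e) \<Rightarrow> bool" where
  "successor_listing E l \<longleftrightarrow>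
     (\<forall>e\<in>arcs E. bij_betw (l e) {1..card (out_arcs E (head E e))} (out_arcs E (head E e)))"

definition edge_index :: "nat set \<Rightarrow> (nat \<Rightarrow> 'e) \<Rightarrow> 'e \<Rightarrow> nat" where
  "edge_index I en = inv_into I en"

definition interval_R :: "nat set \<Rightarrow> (nat \<Rightarrow> 'e) \<Rightarrow> 'e \<Rightarrow> real set" where
  "interval_R I en e = {real (edge_index I en e) - 1 ..< real (edge_index I en e)}"

definition interval_D :: "('v, 'e) pre_digraph \<Rightarrow> nat set \<Rightarrow> (nat \<Rightarrow> 'e) \<Rightarrow> 'v \<Rightarrow> real set" where
  "interval_D E I en v = (\<Union>e\<in>out_arcs E v. interval_R I en e)"

definition interval_X :: "('v, 'e) pre_digraph \<Rightarrow> nat set \<Rightarrow> (nat \<Rightarrow> 'e) \<Rightarrow> real set" where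
  "interval_X E I en = (\<Union>e\<in>arcs E. interval_R I en e)"

definition circle_rotation :: "real \<Rightarrow> real \<Rightarrow> real" where
  "circle_rotation \<theta> x = frac (x + \<theta>)"

definition affine_param :: "real \<Rightarrow> real \<Rightarrow> real \<Rightarrow> real" where
  "affine_param a b x = b * x + (1 - x) * a"

definition interval_f ::
  "('v, 'e) pre_digraph \<Rightarrow> nat set \<Rightarrow> (nat \<Rightarrow> 'e) \<Rightarrow> ('e \<Rightarrow> nat \<Rightarrow> 'e) \<Rightarrow> real \<Rightarrow> 'e \<Rightarrow> real \<Rightarrow> real" where
  "interval_f E I en l \<theta> e x =
     (let P = card (out_arcs E (head E e));
          j = real (edge_index I en e);
          k = (THE k. k \<in> {1..P} \<and> x \<in> interval_R I en (l e k));
          i = real (edge_index I en (l e k))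
      in affine_param (j - 1 + (real k - 1) / P) (j - 1 + real k / P)
           (circle_rotation \<theta> (inv_into {0..<1} (affine_param (i - 1) i) x)))"

lemma inv_into_affine_param:
  assumes "0 \<le> z" "z < 1"
  shows "inv_into {0..<1} (affine_param (i - 1) i) (z + i - 1) = z"
proof -
  have *: "affine_param (i - 1) i y = y + i - 1" for y
    by (simp add: affine_param_def algebra_simps)
  have "inj_on (affine_param (i - 1) i) {0..<1}" by (rule inj_onI) (simp add: *)
  then show ?thesis using inv_into_f_f[of "affine_param (i - 1) i" "{0..<1}" z] assms by (simp add: *)
qed

theorem interval_branching_system:
  assumes E: "countable_graph E" "row_finite E" "\<forall>v. \<not> is_sink E v"
    and en: "edge_enumeration E I en" and l: "successor_listing E l"
  shows "algebraic_branching_system E (interval_X E I en) (interval_R I en) (interval_D E I en)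
           (interval_f E I en l \<theta>)"
proof -
  interpret wf_digraph E using E by (simp add: countable_graph_def)
  let ?n = "edge_index I en" and ?R = "interval_R I en" and ?D = "interval_D E I en"
    and ?f = "interval_f E I en l \<theta>"
  have bij: "bij_betw en I (arcs E)" and I: "I \<subseteq> {1..}"
    using en by (auto simp: edge_enumeration_def)
  have inj: "inj_on ?n (arcs E)" and pos: "e \<in> arcs E \<Longrightarrow> 1 \<le> ?n e" for e
    using bij_betw_inv_into[OF bij] I by (auto simp: edge_index_def bij_betw_def)
  have Rdisj: "e = e'" if "e \<in> arcs E" "e' \<in> arcs E" "x \<in> ?R e" "x \<in> ?R e'" for e e' x
  proof -
    have "real (?n e) < real (?n e') + 1" "real (?n e') < real (?n e) + 1"
      using that by (auto simp: interval_R_def)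
    then have "?n e = ?n e'" by linarith
    then show ?thesis using inj that by (auto dest: inj_onD)
  qed
  have "bij_betw (?f e) (?D (head E e)) (?R e)" if e: "e \<in> arcs E" for e
  proof -
    define P where "P = card (out_arcs E (head E e))"
    define j where "j = real (?n e)"
    have P: "0 < P"
      using E e by (auto simp: P_def row_finite_def is_sink_def card_gt_0_iff)
    have lb: "bij_betw (l e) {1..P} (out_arcs E (head E e))"
      using l e by (auto simp: successor_listing_def P_def)
    have la: "l e k \<in> arcs E" "l e k \<in> out_arcs E (head E e)" if "k \<in> {1..P}" for k
      using bij_betwE[OF lb] that by auto
    have val: "?f e (z + real (?n (l e k)) - 1) = j - 1 + (real k - 1 + frac (z + \<theta>)) / P"
      and inR: "z + real (?n (l e k)) - 1 \<in> ?R (l e k)"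
      if "k \<in> {1..P}" "0 \<le> z" "z < 1" for k and z :: real
    proof -
      show R: "z + real (?n (l e k)) - 1 \<in> ?R (l e k)"
        using that pos[OF la(1)[OF that(1)]] by (simp add: interval_R_def)
      have "(THE k'. k' \<in> {1..P} \<and> z + real (?n (l e k)) - 1 \<in> ?R (l e k')) = k"
      proof (rule the_equality)
        show "k \<in> {1..P} \<and> z + real (?n (l e k)) - 1 \<in> ?R (l e k)" using that R by blast
        fix k' assume k': "k' \<in> {1..P} \<and> z + real (?n (l e k)) - 1 \<in> ?R (l e k')"
        then have "l e k' = l e k" using Rdisj la R that(1) by blast
        then show "k' = k" using lb k' that(1) by (auto simp: bij_betw_def dest: inj_onD)
      qed
      then have "?f e (z + real (?n (l e k)) - 1)
          = affine_param (j - 1 + (real k - 1) / P) (j - 1 + real k / P) (circle_rotation \<theta> z)"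
        using inv_into_affine_param[OF that(2,3), of "real (?n (l e k))"]
        by (simp add: interval_f_def Let_def P_def j_def)
      then show "?f e (z + real (?n (l e k)) - 1) = j - 1 + (real k - 1 + frac (z + \<theta>)) / P"
        by (simp add: affine_param_def circle_rotation_def add_divide_distrib diff_divide_distrib algebra_simps)
    qed
    have dom: "\<exists>k (z::real). k \<in> {1..P} \<and> 0 \<le> z \<and> z < 1 \<and> x = z + real (?n (l e k)) - 1" if x: "x \<in> ?D (head E e)" for x
    proof -
      obtain e' where e': "e' \<in> out_arcs E (head E e)" "x \<in> ?R e'"
        using x by (auto simp: interval_D_def)
      then obtain k where k: "k \<in> {1..P}" "e' = l e k"
        using lb e'(1) unfolding bij_betw_def by blast
      have "0 \<le> x - real (?n (l e k)) + 1" "x - real (?n (l e k)) + 1 < 1"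
        using e' k by (auto simp: interval_R_def)
      then show ?thesis using k by (intro exI[of _ k] exI[of _ "x - real (?n (l e k)) + 1"]) auto
    qed
    have frac01: "0 \<le> frac y \<and> frac y < 1" for y :: real
      by (simp add: frac_lt_1)
    show ?thesis
      unfolding bij_betw_def
    proof
      show "inj_on (?f e) (?D (head E e))"
      proof (rule inj_onI)
        fix x y assume "x \<in> ?D (head E e)" "y \<in> ?D (head E e)" and eq: "?f e x = ?f e y"
        then obtain k z k' z' where k: "k \<in> {1..P}" "0 \<le> z" "z < 1" "x = z + real (?n (l e k)) - 1"
          and k': "k' \<in> {1..P}" "0 \<le> z'" "z' < 1" "y = z' + real (?n (l e k')) - 1"
          using dom by meson
        have *: "real k + frac (z + \<theta>) = real k' + frac (z' + \<theta>)"
          using eq val[OF k(1-3)] val[OF k'(1-3)] k(4) k'(4) P by simp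
        have "real k < real k' + 1" "real k' < real k + 1"
          using * frac01[of "z + \<theta>"] frac01[of "z' + \<theta>"] by linarith+
        then have kk: "k = k'" by linarith
        then have "frac (z + \<theta>) = frac (z' + \<theta>)" using * by simp
        then have "z - z' = of_int (\<lfloor>z + \<theta>\<rfloor> - \<lfloor>z' + \<theta>\<rfloor>)"
          unfolding frac_def by simp
        then obtain m :: int where m: "z - z' = of_int m" by blast
        then have "m = 0" using k k' by linarith
        then show "x = y" using m k(4) k'(4) kk by simp
      qed
      show "?f e ` ?D (head E e) = ?R e"
      proof (intro equalityI subsetI)
        fix y assume "y \<in> ?f e ` ?D (head E e)"
        then obtain k z where k: "k \<in> {1..P}" "0 \<le> z" "z < 1" "y = ?f e (z + real (?n (l e k)) - 1)"
          using dom by blast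
        then have y: "y = j - 1 + (real k - 1 + frac (z + \<theta>)) / P" using val by simp
        have "real k - 1 + frac (z + \<theta>) \<ge> 0" "real k - 1 + frac (z + \<theta>) < P"
          using k frac01[of "z + \<theta>"] by (auto intro: add_nonneg_nonneg) 
        then show "y \<in> ?R e" using P by (simp add: y interval_R_def j_def)
      next
        fix y assume "y \<in> ?R e"
        then have y: "0 \<le> y - (j - 1)" "y - (j - 1) < 1" by (auto simp: interval_R_def j_def)
        define u where "u = P * (y - (j - 1))"
        define k where "k = nat \<lfloor>u\<rfloor> + 1"
        define w where "w = frac u"
        define z where "z = frac (w - \<theta>)"
        have u: "0 \<le> u" "u < P" using y P by (auto simp: u_def)
        have k: "k \<in> {1..P}" using u by (simp add: k_def) linarith
        have uk: "u = real k - 1 + w" using u by (simp add: k_def w_def frac_def)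
        have z: "0 \<le> z" "z < 1" using frac01 by (auto simp: z_def)
        have "frac (z + \<theta>) = w"
        proof -
          have "z + \<theta> = w + of_int (- \<lfloor>w - \<theta>\<rfloor>)" by (simp add: z_def frac_def)
          moreover have "0 \<le> w" "w < 1" using frac01 by (auto simp: w_def)
          ultimately show ?thesis by (metis add.commute frac_add_of_int_left frac_eq)
        qed
        moreover have "u / P = y - (j - 1)" using P by (simp add: u_def)
        ultimately have "?f e (z + real (?n (l e k)) - 1) = y"
          using val[OF k z] by (simp flip: uk)
        moreover have "z + real (?n (l e k)) - 1 \<in> ?D (head E e)"
          using inR[OF k z] la[OF k] unfolding interval_D_def by blast
        ultimately show "y \<in> ?f e ` ?D (head E e)" by (metis image_eqI)
      qed
    qed
  qed
  moreover have "disjoint_family_on ?R (arcs E)"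
    unfolding disjoint_family_on_def using Rdisj by blast
  moreover have "disjoint_family_on ?D (verts E)"
    unfolding disjoint_family_on_def
  proof (intro ballI impI equals0I)
    fix v w x assume "v \<noteq> w" and "x \<in> ?D v \<inter> ?D w"
    then obtain e e' where e: "e \<in> arcs E" "tail E e = v" "x \<in> ?R e"
      and e': "e' \<in> arcs E" "tail E e' = w" "x \<in> ?R e'"
      unfolding interval_D_def by auto
    then show False using Rdisj[OF e(1) e'(1) e(3) e'(3)] \<open>v \<noteq> w\<close> by simp
  qed
  moreover have "?R e \<subseteq> interval_X E I en" "?R e \<subseteq> ?D (tail E e)" if "e \<in> arcs E" for e
    using that by (auto simp: interval_X_def interval_D_def)
  moreover have "?D v \<subseteq> interval_X E I en" for v
    by (auto simp: interval_X_def interval_D_def)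
  ultimately show ?thesis
    by (simp add: algebraic_branching_system_def interval_D_def)
qed

end

(*
  Since E is row-finite without sinks, v is the sum of nu nu^* over the paths nu of length n from v.
  Hence a nonzero x in L_K(E) has some x nu nonzero, and for large n this product is a linear
  combination of real paths ending at w = r(nu). The path mu maps the point mass at y in D_w to the
  point mass at f_mu(y), so it suffices to find y in D_w whose images under different paths ending
  at w are different, that is, a y fixed by no nonempty closed path at w. Along every nonempty path
  f_mu(y) = a y + q theta + r with a, q, r rational and q > 0. Hence, theta being irrational, every
  y outside the countable set Q + Q theta will do. Closed paths without exits need no separate
  treatment: they are the case a = 1.
*)

theory Submission
  imports Defs "Graph_Theory.Arc_Walk" "HOL-Analysis.Continuum_Not_Denumerable"
begin

section \<open>Linear spans\<close>

text \<open>Spans are generated inductively, so that linearity arguments become rule inductions.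
  Explicit linear combinations are extracted only in \<open>algebra_span_image\<close>.\<close>

inductive_set algebra_span :: "('k::field, 'a) module \<Rightarrow> 'a set \<Rightarrow> 'a set" for A U where
  zero: "\<zero>\<^bsub>A\<^esub> \<in> algebra_span A U"
| base: "u \<in> U \<Longrightarrow> u \<in> algebra_span A U"
| add: "x \<in> algebra_span A U \<Longrightarrow> y \<in> algebra_span A U \<Longrightarrow> x \<oplus>\<^bsub>A\<^esub> y \<in> algebra_span A U"
| smult: "x \<in> algebra_span A U \<Longrightarrow> c \<odot>\<^bsub>A\<^esub> x \<in> algebra_span A U"

lemma algebra_span_mono: "x \<in> algebra_span A U \<Longrightarrow> U \<subseteq> V \<Longrightarrow> x \<in> algebra_span A V"
  by (induction rule: algebra_span.induct) (auto intro: algebra_span.intros)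

context field_algebra
begin

lemma smult_zero_right: "c \<odot> \<zero> = \<zero>"
  using smult_assoc1[of \<zero> c 0] by (simp add: smult_zero)

text \<open>Zero equals the scalar 0 times itself, and that scalar can be moved out of the
  product.\<close>

lemma mult_zero_r: "x \<in> carrier A \<Longrightarrow> x \<otimes> \<zero> = \<zero>"
  using smult_mult_r[of x \<zero> 0] by (simp add: smult_zero mult_closed)

lemma mult_zero_l: "x \<in> carrier A \<Longrightarrow> \<zero> \<otimes> x = \<zero>"
  using smult_mult_l[of \<zero> x 0] by (simp add: smult_zero mult_closed)

lemma mult_finsum:
  assumes "finite F" "x \<in> carrier A" "f \<in> F \<rightarrow> carrier A"
  shows "x \<otimes> (\<Oplus>i\<in>F. f i) = (\<Oplus>i\<in>F. x \<otimes> f i)"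
  using assms(1,3)
proof (induction F)
  case empty
  then show ?case using assms(2) by (simp add: mult_zero_r)
next
  case (insert i F)
  then have "(\<lambda>i. x \<otimes> f i) \<in> F \<rightarrow> carrier A" "x \<otimes> f i \<in> carrier A"
    using assms(2) by (auto intro: mult_closed)
  then show ?case using insert assms(2) by (simp add: r_distr)
qed

lemma smult_finsum:
  assumes "finite F" "f \<in> F \<rightarrow> carrier A"
  shows "c \<odot> (\<Oplus>i\<in>F. f i) = (\<Oplus>i\<in>F. c \<odot> f i)"
  using assms
proof (induction F)
  case empty
  then show ?case by (simp add: smult_zero_right)
next
  case (insert i F)
  then have "(\<lambda>i. c \<odot> f i) \<in> F \<rightarrow> carrier A" "c \<odot> f i \<in> carrier A"
    by (auto intro: smult_closed)
  then show ?case using insert by (simp add: smult_r_distr)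
qed

lemma algebra_span_closed: "x \<in> algebra_span A U \<Longrightarrow> U \<subseteq> carrier A \<Longrightarrow> x \<in> carrier A"
  by (induction rule: algebra_span.induct) (auto simp: smult_closed)

lemma algebra_span_mult:
  assumes "x \<in> carrier A" "U \<subseteq> carrier A" "\<And>u. u \<in> U \<Longrightarrow> x \<otimes> u \<in> algebra_span A V"
    and "y \<in> algebra_span A U"
  shows "x \<otimes> y \<in> algebra_span A V"
  using assms(4)
proof (induction rule: algebra_span.induct)
  case (add y z)
  then show ?case
    using algebra_span_closed[OF _ assms(2)] by (simp add: r_distr assms(1) algebra_span.add)
next
  case (smult y c)
  then show ?case
    using algebra_span_closed[OF _ assms(2)] by (simp add: smult_mult_r assms(1) algebra_span.smult)
qed (simp_all add: assms mult_zero_r algebra_span.zero)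

text \<open>Indexing the sum by \<open>S\<close>, and not by its image under \<open>u\<close>, lets
  coefficients be attached to paths later on without first knowing that distinct paths give distinct
  elements.\<close>

lemma algebra_span_image:
  assumes u: "u \<in> S \<rightarrow> carrier A" and "x \<in> algebra_span A (u ` S)"
  shows "\<exists>F c. finite F \<and> F \<subseteq> S \<and> x = (\<Oplus>i\<in>F. c i \<odot> u i)"
  using assms(2)
proof (induction rule: algebra_span.induct)
  case zero
  show ?case by (intro exI[of _ "{}"]) simp
next
  case (base x)
  then obtain i where i: "i \<in> S" "x = u i" by blast
  then have "u i \<in> carrier A" using u by blast
  then have "(\<Oplus>j\<in>{i}. 1 \<odot> u j) = u i"
    by (subst finsum_insert) (auto simp: smult_one smult_closed)
  then show ?case using i by (intro exI[of _ "{i}"] exI[of _ "\<lambda>_. 1"]) simp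
next
  case (add x y)
  then obtain F c G d where F: "finite F" "F \<subseteq> S" "x = (\<Oplus>i\<in>F. c i \<odot> u i)"
    and G: "finite G" "G \<subseteq> S" "y = (\<Oplus>i\<in>G. d i \<odot> u i)" by blast
  have uFG: "u i \<in> carrier A" if "i \<in> F \<union> G" for i using that F(2) G(2) u by blast
  \<comment> \<open>Padding the coefficients by 0 makes both sums run over the common index set
    \<open>F \<union> G\<close>.\<close>
  have extend: "(\<Oplus>i\<in>H. b i \<odot> u i) = (\<Oplus>i\<in>F \<union> G. (if i \<in> H then b i else 0) \<odot> u i)"
    if "H \<subseteq> F \<union> G" for b H
    using that F(1) G(1) uFG
    by (intro add.finprod_mono_neutral_cong_left) (auto simp: smult_closed smult_zero)
  have "x \<oplus> y = (\<Oplus>i\<in>F \<union> G. (if i \<in> F then c i else 0) \<odot> u i) \<oplus>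
      (\<Oplus>i\<in>F \<union> G. (if i \<in> G then d i else 0) \<odot> u i)"
    using extend[of F c] extend[of G d] F(3) G(3) by simp
  also have "\<dots> = (\<Oplus>i\<in>F \<union> G. (if i \<in> F then c i else 0) \<odot> u i \<oplus> (if i \<in> G then d i else 0) \<odot> u i)"
    using uFG by (intro finsum_addf[symmetric]) (auto simp: smult_closed)
  also have "\<dots> = (\<Oplus>i\<in>F \<union> G. ((if i \<in> F then c i else 0) + (if i \<in> G then d i else 0)) \<odot> u i)"
    by (intro finsum_cong' HOL.refl funcsetI smult_closed smult_l_distr[symmetric] uFG)
  finally show ?case using F(1,2) G(1,2)
    by (intro exI[of _ "F \<union> G"] exI[of _ "\<lambda>i. (if i \<in> F then c i else 0) + (if i \<in> G then d i else 0)"]) simp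
next
  case (smult x c)
  then obtain F d where F: "finite F" "F \<subseteq> S" "x = (\<Oplus>i\<in>F. d i \<odot> u i)" by blast
  have uF: "u i \<in> carrier A" if "i \<in> F" for i using that F(2) u by blast
  have "c \<odot> x = (\<Oplus>i\<in>F. c \<odot> (d i \<odot> u i))"
    unfolding F(3) using F(1) uF by (intro smult_finsum) (auto simp: smult_closed)
  also have "\<dots> = (\<Oplus>i\<in>F. (c * d i) \<odot> u i)"
    using uF by (intro finsum_cong') (auto simp: smult_closed smult_assoc1)
  finally show ?case using F(1,2) by (intro exI[of _ F] exI[of _ "\<lambda>i. c * d i"]) simp
qed

end

section \<open>Paths in an algebra carrying a Leavitt family\<close>

text \<open>The arguments below use only the defining relations and the values of terms. They are
  applied later to the Leavitt path algebra with its own generators.\<close>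

locale leavitt_family_algebra = field_algebra A + wf_digraph E
  for A :: "('k::field, 'a) module" (structure) and E :: "('v, 'e) pre_digraph" +
  fixes p :: "'v \<Rightarrow> 'a" and s t :: "'e \<Rightarrow> 'a"
  assumes family: "leavitt_family E A p s t"
begin

section \<open>Products of a generator with a path\<close>

lemma
  shows vertex_closed: "v \<in> verts E \<Longrightarrow> p v \<in> carrier A"
    and edge_closed: "e \<in> arcs E \<Longrightarrow> s e \<in> carrier A"
    and ghost_closed: "e \<in> arcs E \<Longrightarrow> t e \<in> carrier A"
    and vertex_vertex: "v \<in> verts E \<Longrightarrow> w \<in> verts E \<Longrightarrow> p v \<otimes> p w = (if v = w then p v else \<zero>)"
    and tail_edge: "e \<in> arcs E \<Longrightarrow> p (tail E e) \<otimes> s e = s e"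
    and edge_head: "e \<in> arcs E \<Longrightarrow> s e \<otimes> p (head E e) = s e"
    and ghost_tail: "e \<in> arcs E \<Longrightarrow> t e \<otimes> p (tail E e) = t e"
    and ghost_edge: "e \<in> arcs E \<Longrightarrow> f \<in> arcs E \<Longrightarrow> t e \<otimes> s f = (if e = f then p (head E e) else \<zero>)"
    and vertex_sum: "v \<in> verts E \<Longrightarrow> finite (out_arcs E v) \<Longrightarrow> out_arcs E v \<noteq> {} \<Longrightarrow>
          p v = (\<Oplus>e\<in>out_arcs E v. s e \<otimes> t e)"
  using family by (simp_all add: leavitt_family_def)

text \<open>The end vertex is a separate argument because the empty list does not determine it: the
  empty path at \<open>w\<close> is the idempotent \<open>p w\<close>. On a nonempty path to
  \<open>w\<close> this final idempotent is absorbed by the last edge.\<close>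

primrec path_element :: "'e list \<Rightarrow> 'v \<Rightarrow> 'a" where
  "path_element [] w = p w"
| "path_element (e # \<mu>) w = s e \<otimes> path_element \<mu> w"

lemma path_element_closed: "awalk u \<mu> w \<Longrightarrow> path_element \<mu> w \<in> carrier A"
  by (induction \<mu> arbitrary: u)
    (auto simp: awalk_Nil_iff awalk_Cons_iff vertex_closed edge_closed mult_closed)

text \<open>A nonempty path starts with \<open>s e = p (tail E e) \<otimes> s e\<close>, so
  orthogonality of the vertices decides the product.\<close>

lemma vertex_path:
  assumes "awalk u \<mu> w" "v \<in> verts E"
  shows "p v \<otimes> path_element \<mu> w = (if u = v then path_element \<mu> w else \<zero>)"
proof (cases \<mu>)
  case Nil
  then show ?thesis using assms by (auto simp: awalk_Nil_iff vertex_vertex)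
next
  case (Cons e \<mu>')
  have e: "e \<in> arcs E" "u = tail E e" and \<mu>': "path_element \<mu>' w \<in> carrier A"
    using assms Cons by (auto simp: awalk_Cons_iff intro: path_element_closed)
  have "p v \<otimes> path_element \<mu> w = p v \<otimes> (p u \<otimes> s e \<otimes> path_element \<mu>' w)"
    using e by (simp add: tail_edge Cons)
  also have "\<dots> = (p v \<otimes> p u) \<otimes> s e \<otimes> path_element \<mu>' w"
    using e \<mu>' assms(2) by (simp add: mult_assoc vertex_closed edge_closed mult_closed)
  also have "\<dots> = (if u = v then path_element \<mu> w else \<zero>)"
    using e assms(2) \<mu>' by (auto simp: vertex_vertex mult_zero_l edge_closed tail_edge Cons)
  finally show ?thesis .
qed

text \<open>The idempotent \<open>p (head E e)\<close> can be inserted between the factors, which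
  reduces the claim to \<open>vertex_path\<close>.\<close>

lemma edge_path:
  assumes "awalk u \<mu> w" "e \<in> arcs E"
  shows "s e \<otimes> path_element \<mu> w = (if head E e = u then path_element (e # \<mu>) w else \<zero>)"
proof -
  have "s e \<otimes> path_element \<mu> w = s e \<otimes> (p (head E e) \<otimes> path_element \<mu> w)"
    using assms path_element_closed[OF assms(1)] edge_head[OF assms(2)]
    by (simp flip: mult_assoc add: vertex_closed edge_closed)
  also have "\<dots> = (if head E e = u then path_element (e # \<mu>) w else \<zero>)"
    using assms vertex_path[OF assms(1), of "head E e"] by (simp add: mult_zero_r edge_closed)
  finally show ?thesis .
qed

lemma ghost_path:
  assumes "awalk u (f # \<mu>) w" "e \<in> arcs E"
  shows "t e \<otimes> path_element (f # \<mu>) w = (if e = f then path_element \<mu> w else \<zero>)"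
proof -
  have f: "f \<in> arcs E" and \<mu>: "awalk (head E f) \<mu> w"
    using assms by (auto simp: awalk_Cons_iff)
  have "t e \<otimes> path_element (f # \<mu>) w = (t e \<otimes> s f) \<otimes> path_element \<mu> w"
    using assms f path_element_closed[OF \<mu>] by (simp add: mult_assoc ghost_closed edge_closed)
  \<comment> \<open>For \<open>e = f\<close> the relation leaves \<open>p (head E f)\<close>, which
    the rest of the path absorbs.\<close>
  also have "\<dots> = (if e = f then path_element \<mu> w else \<zero>)"
    using assms(2) f path_element_closed[OF \<mu>] vertex_path[OF \<mu>] by (simp add: ghost_edge mult_zero_l)
  finally show ?thesis .
qed

section \<open>Left multiplication on spans of long paths\<close>

definition paths_to :: "'v \<Rightarrow> nat \<Rightarrow> 'e list set" where
  "paths_to w n = {\<mu>. (\<exists>u. awalk u \<mu> w) \<and> n \<le> length \<mu>}"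

text \<open>Lengths are bounded only from below, so the spans decrease as \<open>n\<close> grows.
  Elements with different length bounds can thus be placed in one common span.\<close>

definition path_span :: "'v \<Rightarrow> nat \<Rightarrow> 'a set" where
  "path_span w n = algebra_span A ((\<lambda>\<mu>. path_element \<mu> w) ` paths_to w n)"

lemma paths_to_closed: "(\<lambda>\<mu>. path_element \<mu> w) ` paths_to w n \<subseteq> carrier A"
  by (auto simp: paths_to_def intro: path_element_closed)

lemma path_in_span: "awalk u \<mu> w \<Longrightarrow> n \<le> length \<mu> \<Longrightarrow> path_element \<mu> w \<in> path_span w n"
  by (auto simp: path_span_def paths_to_def intro: algebra_span.base)

lemma
  shows path_span_zero: "\<zero> \<in> path_span w n"
    and path_span_add: "x \<in> path_span w n \<Longrightarrow> y \<in> path_span w n \<Longrightarrow> x \<oplus> y \<in> path_span w n"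
    and path_span_smult: "x \<in> path_span w n \<Longrightarrow> c \<odot> x \<in> path_span w n"
  unfolding path_span_def by (rule algebra_span.intros; assumption)+

lemma path_span_mono: "m \<le> n \<Longrightarrow> x \<in> path_span w n \<Longrightarrow> x \<in> path_span w m"
  unfolding path_span_def by (rule algebra_span_mono) (auto simp: paths_to_def)

lemma path_span_mult:
  assumes "x \<in> carrier A" "\<And>\<mu>. \<mu> \<in> paths_to w n \<Longrightarrow> x \<otimes> path_element \<mu> w \<in> path_span w m"
    and "y \<in> path_span w n"
  shows "x \<otimes> y \<in> path_span w m"
  unfolding path_span_def
proof (rule algebra_span_mult[OF assms(1) paths_to_closed])
  show "y \<in> algebra_span A ((\<lambda>\<mu>. path_element \<mu> w) ` paths_to w n)"
    using assms(3) by (simp only: path_span_def)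
qed (use assms(2) in \<open>auto simp: path_span_def\<close>)

text \<open>The lower bound on the lengths of the resulting paths is what the case of products needs.\<close>

lemma term_value_path:
  assumes "term_over E x"
  shows "\<exists>n. \<forall>u \<nu> w. awalk u \<nu> w \<longrightarrow> n \<le> length \<nu> \<longrightarrow>
    term_value A p s t x \<otimes> path_element \<nu> w \<in> path_span w (length \<nu> - n)"
  using assms
proof (induction x)
  case (Vertex v)
  then show ?case
    by (intro exI[of _ 0]) (auto simp: vertex_path path_in_span path_span_zero)
next
  case (Edge e)
  show ?case
  proof (intro exI[of _ 0] allI impI)
    fix u \<nu> w assume \<nu>: "awalk u \<nu> w"
    have "path_element (e # \<nu>) w \<in> path_span w (length \<nu>)" if "head E e = u"
      using that \<nu> Edge by (intro path_in_span[of "tail E e"]) (simp_all add: awalk_Cons_iff)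
    then show "term_value A p s t (Edge e) \<otimes> path_element \<nu> w \<in> path_span w (length \<nu> - 0)"
      using Edge edge_path[OF \<nu>, of e] by (simp add: path_span_zero del: path_element.simps)
  qed
next
  case (Ghost e)
  show ?case
  \<comment> \<open>A ghost edge may strip the first edge of the path, so the path must be nonempty
    and the bound drops by 1. The other generators need no minimal length.\<close>
  proof (intro exI[of _ 1] allI impI)
    fix u \<nu> w assume \<nu>: "awalk u \<nu> w" and "1 \<le> length \<nu>"
    then obtain f \<mu> where \<mu>: "\<nu> = f # \<mu>" by (cases \<nu>) auto
    then have "awalk (head E f) \<mu> w" using \<nu> by (simp add: awalk_Cons_iff)
    then have "path_element \<mu> w \<in> path_span w (length \<mu>)" by (auto intro: path_in_span)
    then show "term_value A p s t (Ghost e) \<otimes> path_element \<nu> w \<in> path_span w (length \<nu> - 1)"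
      using Ghost \<nu> \<mu> ghost_path[of u f \<mu> w e] by (simp add: path_span_zero)
  qed
next
  case Zero
  show ?case
    by (intro exI[of _ 0])
      (auto simp: mult_zero_l path_element_closed path_span_zero)
next
  case (Plus x y)
  then obtain m n where m: "\<And>u \<nu> w. awalk u \<nu> w \<Longrightarrow> m \<le> length \<nu> \<Longrightarrow>
      term_value A p s t x \<otimes> path_element \<nu> w \<in> path_span w (length \<nu> - m)"
    and n: "\<And>u \<nu> w. awalk u \<nu> w \<Longrightarrow> n \<le> length \<nu> \<Longrightarrow>
      term_value A p s t y \<otimes> path_element \<nu> w \<in> path_span w (length \<nu> - n)"
    by (metis term_over.simps(5))
  show ?case
  \<comment> \<open>Any common upper bound of \<open>m\<close> and \<open>n\<close> serves here,
    since the spans are monotone.\<close>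
  proof (intro exI[of _ "m + n"] allI impI)
    fix u \<nu> w assume \<nu>: "awalk u \<nu> w" "m + n \<le> length \<nu>"
    have "term_value A p s t x \<otimes> path_element \<nu> w \<in> path_span w (length \<nu> - (m + n))"
      "term_value A p s t y \<otimes> path_element \<nu> w \<in> path_span w (length \<nu> - (m + n))"
      using m[OF \<nu>(1)] n[OF \<nu>(1)] \<nu>(2)
      by (auto intro: path_span_mono[of "length \<nu> - (m + n)" "length \<nu> - m"]
          path_span_mono[of "length \<nu> - (m + n)" "length \<nu> - n"])
    then show "term_value A p s t (Plus x y) \<otimes> path_element \<nu> w \<in> path_span w (length \<nu> - (m + n))"
      using Plus.prems term_value_closed[OF family] path_element_closed[OF \<nu>(1)]
      by (simp add: l_distr path_span_add)
  qed
next
  case (Times x y)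
  then obtain m n where m: "\<And>u \<nu> w. awalk u \<nu> w \<Longrightarrow> m \<le> length \<nu> \<Longrightarrow>
      term_value A p s t x \<otimes> path_element \<nu> w \<in> path_span w (length \<nu> - m)"
    and n: "\<And>u \<nu> w. awalk u \<nu> w \<Longrightarrow> n \<le> length \<nu> \<Longrightarrow>
      term_value A p s t y \<otimes> path_element \<nu> w \<in> path_span w (length \<nu> - n)"
    by (metis term_over.simps(6))
  show ?case
  proof (intro exI[of _ "m + n"] allI impI)
    fix u \<nu> w assume \<nu>: "awalk u \<nu> w" "m + n \<le> length \<nu>"
    \<comment> \<open>Multiplication by \<open>y\<close> produces paths of length at least
      \<open>length \<nu> - n\<close>. This is at least \<open>m\<close>, so the bound for
      \<open>x\<close> applies to each of them.\<close>
    have x: "term_value A p s t x \<otimes> path_element \<mu> w \<in> path_span w (length \<nu> - (m + n))"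
      if "\<mu> \<in> paths_to w (length \<nu> - n)" for \<mu>
      using that \<nu>(2) m[of _ \<mu> w]
      by (auto simp: paths_to_def intro: path_span_mono[of "length \<nu> - (m + n)" "length \<mu> - m"])
    have "term_value A p s t y \<otimes> path_element \<nu> w \<in> path_span w (length \<nu> - n)"
      using n \<nu> by simp
    then have "term_value A p s t x \<otimes> (term_value A p s t y \<otimes> path_element \<nu> w)
        \<in> path_span w (length \<nu> - (m + n))"
      using Times.prems by (intro path_span_mult[OF _ x] term_value_closed[OF family]) simp_all
    then show "term_value A p s t (Times x y) \<otimes> path_element \<nu> w \<in> path_span w (length \<nu> - (m + n))"
      using Times.prems term_value_closed[OF family] path_element_closed[OF \<nu>(1)]
      by (simp add: mult_assoc)
  qed
next
  case (Scale c x)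
  then obtain n where n: "\<And>u \<nu> w. awalk u \<nu> w \<Longrightarrow> n \<le> length \<nu> \<Longrightarrow>
      term_value A p s t x \<otimes> path_element \<nu> w \<in> path_span w (length \<nu> - n)"
    by auto
  show ?case
    using Scale.prems n term_value_closed[OF family] path_element_closed
    by (intro exI[of _ n]) (auto simp: smult_mult_l path_span_smult)
qed

section \<open>Local units and detection of zero by right multiplication\<close>

lemma unit_closed: "G \<subseteq> verts E \<Longrightarrow> (\<Oplus>w\<in>G. p w) \<in> carrier A"
  using vertex_closed by (intro finsum_closed) auto

lemma vertex_local_unit:
  assumes "finite G" "G \<subseteq> verts E" "v \<in> G"
  shows "p v \<otimes> (\<Oplus>w\<in>G. p w) = p v"
proof -
  have "p v \<otimes> (\<Oplus>w\<in>G. p w) = (\<Oplus>w\<in>G. p v \<otimes> p w)"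
    using assms vertex_closed by (intro mult_finsum) auto
  also have "\<dots> = (\<Oplus>w\<in>G. if v = w then p w else \<zero>)"
    using assms vertex_closed by (intro finsum_cong') (auto simp: vertex_vertex subset_iff)
  also have "\<dots> = p v"
    using assms vertex_closed by (intro finsum_singleton) auto
  finally show ?thesis .
qed

text \<open>The algebra need not have a unit, but finite sums of vertices act as right units on any
  given term. Allowing every larger finite set \<open>G\<close> makes the claim survive sums, where
  the sets of both summands are united.\<close>

lemma term_local_unit:
  assumes "term_over E x"
  shows "\<exists>F. finite F \<and> F \<subseteq> verts E \<and> (\<forall>G. finite G \<longrightarrow> F \<subseteq> G \<longrightarrow> G \<subseteq> verts E \<longrightarrow>
    term_value A p s t x \<otimes> (\<Oplus>w\<in>G. p w) = term_value A p s t x)"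
  using assms
proof (induction x)
  case (Vertex v)
  then show ?case by (intro exI[of _ "{v}"]) (auto simp: vertex_local_unit)
next
  case (Edge e)
  have "s e \<otimes> (\<Oplus>w\<in>G. p w) = s e" if "finite G" "head E e \<in> G" "G \<subseteq> verts E" for G
    using mult_assoc[of "s e" "p (head E e)" "\<Oplus>w\<in>G. p w"] that Edge unit_closed[of G]
    by (simp add: edge_closed vertex_closed edge_head vertex_local_unit)
  then show ?case using Edge by (intro exI[of _ "{head E e}"]) auto
next
  case (Ghost e)
  have "t e \<otimes> (\<Oplus>w\<in>G. p w) = t e" if "finite G" "tail E e \<in> G" "G \<subseteq> verts E" for G
    using mult_assoc[of "t e" "p (tail E e)" "\<Oplus>w\<in>G. p w"] that Ghost unit_closed[of G]
    by (simp add: ghost_closed vertex_closed ghost_tail vertex_local_unit)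
  then show ?case using Ghost by (intro exI[of _ "{tail E e}"]) auto
next
  case Zero
  show ?case using unit_closed by (intro exI[of _ "{}"]) (auto simp: mult_zero_l)
next
  case (Plus x y)
  have cl: "term_value A p s t x \<in> carrier A" "term_value A p s t y \<in> carrier A"
    using Plus.prems by (simp_all add: term_value_closed[OF family])
  obtain F where F: "finite F" "F \<subseteq> verts E"
    "\<And>H. finite H \<Longrightarrow> F \<subseteq> H \<Longrightarrow> H \<subseteq> verts E \<Longrightarrow>
      term_value A p s t x \<otimes> (\<Oplus>w\<in>H. p w) = term_value A p s t x"
    using Plus.IH(1) Plus.prems unfolding term_over.simps by blast
  obtain G where G: "finite G" "G \<subseteq> verts E"
    "\<And>H. finite H \<Longrightarrow> G \<subseteq> H \<Longrightarrow> H \<subseteq> verts E \<Longrightarrow>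
      term_value A p s t y \<otimes> (\<Oplus>w\<in>H. p w) = term_value A p s t y"
    using Plus.IH(2) Plus.prems unfolding term_over.simps by blast
  have "(term_value A p s t x \<oplus> term_value A p s t y) \<otimes> (\<Oplus>w\<in>H. p w) =
      term_value A p s t x \<oplus> term_value A p s t y"
    if "finite H" "F \<union> G \<subseteq> H" "H \<subseteq> verts E" for H
    using that F(3)[of H] G(3)[of H] l_distr[OF cl unit_closed[OF that(3)]] by simp
  then show ?case using F(1,2) G(1,2) by (intro exI[of _ "F \<union> G"]) simp
next
  case (Times x y)
  have cl: "term_value A p s t x \<in> carrier A" "term_value A p s t y \<in> carrier A"
    using Times.prems by (simp_all add: term_value_closed[OF family])
  \<comment> \<open>A right unit for the right factor is a right unit for the product.\<close>
  obtain G where G: "finite G" "G \<subseteq> verts E"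
    "\<And>H. finite H \<Longrightarrow> G \<subseteq> H \<Longrightarrow> H \<subseteq> verts E \<Longrightarrow>
      term_value A p s t y \<otimes> (\<Oplus>w\<in>H. p w) = term_value A p s t y"
    using Times.IH(2) Times.prems unfolding term_over.simps by blast
  have "term_value A p s t x \<otimes> term_value A p s t y \<otimes> (\<Oplus>w\<in>H. p w) =
      term_value A p s t x \<otimes> term_value A p s t y"
    if "finite H" "G \<subseteq> H" "H \<subseteq> verts E" for H
    using G(3)[OF that] mult_assoc[OF cl unit_closed[OF that(3)]] by simp
  then show ?case using G(1,2) by (intro exI[of _ G]) simp
next
  case (Scale c x)
  have cl: "term_value A p s t x \<in> carrier A"
    using Scale.prems by (simp add: term_value_closed[OF family])
  obtain G where G: "finite G" "G \<subseteq> verts E"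
    "\<And>H. finite H \<Longrightarrow> G \<subseteq> H \<Longrightarrow> H \<subseteq> verts E \<Longrightarrow>
      term_value A p s t x \<otimes> (\<Oplus>w\<in>H. p w) = term_value A p s t x"
    using Scale.IH Scale.prems unfolding term_over.simps by blast
  have "c \<odot> term_value A p s t x \<otimes> (\<Oplus>w\<in>H. p w) = c \<odot> term_value A p s t x"
    if "finite H" "G \<subseteq> H" "H \<subseteq> verts E" for H
    using G(3)[OF that] smult_mult_l[OF cl unit_closed[OF that(3)]] by simp
  then show ?case using G(1,2) by (intro exI[of _ G]) simp
qed

text \<open>A suitable finite sum of vertices fixes the element from the right, and distributing the
  product over this sum gives only zeros.\<close>

lemma term_value_eq_zeroI:
  assumes "term_over E x" and zero: "\<And>v. v \<in> verts E \<Longrightarrow> term_value A p s t x \<otimes> p v = \<zero>"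
  shows "term_value A p s t x = \<zero>"
proof -
  obtain F where F: "finite F" "F \<subseteq> verts E"
    "term_value A p s t x \<otimes> (\<Oplus>w\<in>F. p w) = term_value A p s t x"
    using term_local_unit[OF assms(1)] by blast
  have "term_value A p s t x \<otimes> (\<Oplus>w\<in>F. p w) = (\<Oplus>w\<in>F. term_value A p s t x \<otimes> p w)"
    using F assms(1) vertex_closed term_value_closed[OF family] by (intro mult_finsum) auto
  also have "\<dots> = (\<Oplus>w\<in>F. \<zero>)"
    using F zero by (intro finsum_cong') auto
  finally show ?thesis using F(3) by simp
qed

text \<open>This replaces the expansion of a vertex over all paths of length \<open>n\<close> by an
  induction that expands it one edge at a time. Row-finiteness and the absence of sinks make
  \<open>vertex_sum\<close> applicable at every vertex.\<close>

lemma mult_vertex_eq_zeroI: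
  assumes "row_finite E" "\<And>v. \<not> is_sink E v"
    and "a \<in> carrier A" "\<And>u \<nu> w. awalk u \<nu> w \<Longrightarrow> length \<nu> = n \<Longrightarrow> a \<otimes> path_element \<nu> w = \<zero>"
    and "v \<in> verts E"
  shows "a \<otimes> p v = \<zero>"
  using assms(3-5)
proof (induction n arbitrary: a v)
  case 0
  then show ?case using 0(2)[of v "[]" v] by (simp add: awalk_Nil_iff)
next
  case (Suc n)
  have ae: "a \<otimes> s e = \<zero>" if e: "e \<in> arcs E" for e
  proof -
    have cl: "a \<otimes> s e \<in> carrier A" using e Suc.prems(1) by (simp add: mult_closed edge_closed)
    have "a \<otimes> s e \<otimes> path_element \<nu> w = \<zero>" if \<nu>: "awalk u \<nu> w" "length \<nu> = n" for u \<nu> w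
    proof (cases "head E e = u")
      case True
      then have "a \<otimes> path_element (e # \<nu>) w = \<zero>"
        using \<nu> e by (intro Suc.prems(2)[of "tail E e"]) (auto simp: awalk_Cons_iff)
      then show ?thesis
        using e Suc.prems(1) path_element_closed[OF \<nu>(1)] by (simp add: mult_assoc edge_closed)
    next
      case False
      then show ?thesis
        using e Suc.prems(1) path_element_closed[OF \<nu>(1)] edge_path[OF \<nu>(1) e]
        by (simp add: mult_assoc edge_closed mult_zero_r)
    qed
    \<comment> \<open>If \<open>a\<close> kills all paths of length \<open>n + 1\<close>, then
      \<open>a \<otimes> s e\<close> kills those of length \<open>n\<close>; this is why the
      induction generalises over \<open>a\<close>.\<close>
    then have "a \<otimes> s e \<otimes> p (head E e) = \<zero>" using Suc.IH[OF cl] e by simp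
    then show ?thesis using e Suc.prems(1) by (simp add: mult_assoc edge_closed vertex_closed edge_head)
  qed
  have out: "finite (out_arcs E v)" "out_arcs E v \<noteq> {}"
    using assms(1,2) Suc.prems(3) by (auto simp: row_finite_def is_sink_def)
  have "a \<otimes> p v = (\<Oplus>e\<in>out_arcs E v. a \<otimes> (s e \<otimes> t e))"
    unfolding vertex_sum[OF Suc.prems(3) out] using out Suc.prems(1)
    by (intro mult_finsum) (auto simp: mult_closed edge_closed ghost_closed)
  also have "\<dots> = (\<Oplus>e\<in>out_arcs E v. \<zero>)"
    using Suc.prems(1) ae
    by (intro finsum_cong') (auto simp flip: mult_assoc simp: edge_closed ghost_closed mult_zero_l)
  finally show ?case by simp
qed

text \<open>The length of \<nu> is taken to be exactly the bound \<open>n\<close> of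
  \<open>term_value_path\<close>: long enough to remove all ghost edges from the product, and still
  a length at which some product is nonzero.\<close>

lemma nonzero_times_path:
  assumes "row_finite E" "\<And>v. \<not> is_sink E v"
    and "term_over E x" "term_value A p s t x \<noteq> \<zero>"
  shows "\<exists>u \<nu> w. awalk u \<nu> w \<and> term_value A p s t x \<otimes> path_element \<nu> w \<noteq> \<zero> \<and>
    (\<exists>F c. finite F \<and> F \<subseteq> {\<mu>. \<exists>u. awalk u \<mu> w} \<and>
       term_value A p s t x \<otimes> path_element \<nu> w = (\<Oplus>\<mu>\<in>F. c \<mu> \<odot> path_element \<mu> w))"
proof -
  obtain n where n: "\<And>u \<nu> w. awalk u \<nu> w \<Longrightarrow> n \<le> length \<nu> \<Longrightarrow>
      term_value A p s t x \<otimes> path_element \<nu> w \<in> path_span w (length \<nu> - n)"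
    using term_value_path[OF assms(3)] by blast
  obtain u \<nu> w where \<nu>: "awalk u \<nu> w" "length \<nu> = n" "term_value A p s t x \<otimes> path_element \<nu> w \<noteq> \<zero>"
    using mult_vertex_eq_zeroI[OF assms(1,2) term_value_closed[OF family assms(3)], of n]
      term_value_eq_zeroI[OF assms(3)] assms(4) by metis
  have "term_value A p s t x \<otimes> path_element \<nu> w \<in> path_span w 0"
    using n[OF \<nu>(1)] \<nu>(2) by simp
  then have "\<exists>F c. finite F \<and> F \<subseteq> paths_to w 0 \<and>
      term_value A p s t x \<otimes> path_element \<nu> w = (\<Oplus>\<mu>\<in>F. c \<mu> \<odot> path_element \<mu> w)"
    unfolding path_span_def using paths_to_closed[of w 0] by (intro algebra_span_image) auto
  then show ?thesis
    using \<nu>(1,3) unfolding paths_to_def by (intro exI[of _ u] exI[of _ \<nu>] exI[of _ w]) simp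
qed

end

section \<open>A faithfulness criterion for induced representations\<close>

context wf_digraph
begin

section \<open>Points of a branching system moved along paths\<close>

lemma branching_disjoint:
  assumes "algebraic_branching_system G X R D f"
  shows "e \<in> arcs G \<Longrightarrow> e' \<in> arcs G \<Longrightarrow> x \<in> R e \<Longrightarrow> x \<in> R e' \<Longrightarrow> e = e'"
    and "v \<in> verts G \<Longrightarrow> w \<in> verts G \<Longrightarrow> x \<in> D v \<Longrightarrow> x \<in> D w \<Longrightarrow> v = w"
  using assms by (auto simp: algebraic_branching_system_def disjoint_family_on_def) blast+

lemma branching_edge:
  assumes "algebraic_branching_system G X R D f" "e \<in> arcs G"
  shows "R e \<subseteq> D (tail G e)" "bij_betw (f e) (D (head G e)) (R e)"
    "x \<in> D (head G e) \<Longrightarrow> f e x \<in> R e"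
proof -
  show "R e \<subseteq> D (tail G e)" and b: "bij_betw (f e) (D (head G e)) (R e)"
    using assms by (auto simp: algebraic_branching_system_def)
  show "x \<in> D (head G e) \<Longrightarrow> f e x \<in> R e" by (rule bij_betwE[OF b, rule_format])
qed

text \<open>The branching maps run against the arrows: \<open>f e\<close> goes from the set of the
  head into the set of the tail, and \<open>foldr\<close> applies the last edge of the path
  first.\<close>

lemma branching_path:
  assumes B: "algebraic_branching_system G X R D f" and "awalk u \<mu> w" "y \<in> D w"
  shows "foldr f \<mu> y \<in> D u"
  using assms(2,3)
proof (induction \<mu> arbitrary: u)
  case (Cons e \<mu>)
  then have e: "e \<in> arcs G" "u = tail G e" and "awalk (head G e) \<mu> w"
    by (auto simp: awalk_Cons_iff)
  then have "foldr f \<mu> y \<in> D (head G e)" using Cons by blast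
  then show ?case using branching_edge(1,3)[OF B e(1)] e(2) by auto
qed (simp add: awalk_Nil_iff)

text \<open>Equal images lie in the same \<open>R e\<close>, so the first edges agree and can be
  cancelled by injectivity of \<open>f e\<close>. Once one path is exhausted, the rest of the other
  fixes \<open>y\<close>.\<close>

lemma branching_path_inj:
  assumes B: "algebraic_branching_system G X R D f" and y: "y \<in> D w"
    and free: "\<And>\<mu>. \<mu> \<noteq> [] \<Longrightarrow> awalk w \<mu> w \<Longrightarrow> foldr f \<mu> y \<noteq> y"
    and "awalk u \<mu> w" "awalk u' \<nu> w" "foldr f \<mu> y = foldr f \<nu> y"
  shows "\<mu> = \<nu>"
proof -
  \<comment> \<open>A path fixing \<open>y\<close> puts \<open>y\<close> into both
    \<open>D u\<close> and \<open>D w\<close>, so it is closed and \<open>free\<close>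
    applies.\<close>
  have nil: "\<mu> = []" if "awalk u \<mu> w" "foldr f \<mu> y = y" for u \<mu>
  proof -
    have "u \<in> verts G" "w \<in> verts G" using that(1) by (auto dest: awalk_hd_in_verts awalk_last_in_verts)
    then have "u = w"
      using branching_path[OF B that(1) y] branching_disjoint(2)[OF B, of u w y] that(2) y by simp
    then show ?thesis using free that by blast
  qed
  show ?thesis using assms(4-6)
  proof (induction \<mu> arbitrary: u u' \<nu>)
    case Nil
    then show ?case using nil[of u' \<nu>] by simp
  next
    case (Cons e \<mu>)
    show ?case
    proof (cases \<nu>)
      case Nil
      then show ?thesis using nil[of u "e # \<mu>"] Cons.prems by simp
    next
      case (Cons e' \<nu>')
      have e: "e \<in> arcs G" "e' \<in> arcs G" and \<mu>: "awalk (head G e) \<mu> w" and \<nu>': "awalk (head G e') \<nu>' w"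
        using Cons.prems Cons by (auto simp: awalk_Cons_iff)
      have D: "foldr f \<mu> y \<in> D (head G e)" "foldr f \<nu>' y \<in> D (head G e')"
        using branching_path[OF B] y \<mu> \<nu>' by blast+
      have eq: "f e (foldr f \<mu> y) = f e' (foldr f \<nu>' y)" using Cons.prems(3) Cons by simp
      have "e = e'"
        using branching_disjoint(1)[OF B e] branching_edge(3)[OF B e(1) D(1)]
          branching_edge(3)[OF B e(2) D(2)] eq by simp
      moreover from this have "foldr f \<mu> y = foldr f \<nu>' y"
        using eq D branching_edge(2)[OF B e(1)] by (auto simp: bij_betw_def dest: inj_onD)
      ultimately show ?thesis using Cons.IH[OF \<mu> \<nu>'] Cons by simp
    qed
  qed
qed

end

section \<open>Point masses under the representation\<close>

definition point_mass :: "'x set \<Rightarrow> 'x \<Rightarrow> 'x \<Rightarrow> 'k::field" where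
  "point_mass X y = (\<lambda>x\<in>X. if x = y then 1 else 0)"

lemma point_mass_in [simp]: "point_mass X y \<in> fun_module X"
  by (simp add: point_mass_def)

text \<open>The operator composes with the inverse of \<open>f e\<close>, so it pushes the support
  of a function forward along \<open>f e\<close>.\<close>

lemma rep_edge_point_mass:
  assumes "bij_betw (f e) (D (head E e)) (R e)" "y \<in> D (head E e)" "D (head E e) \<subseteq> X"
  shows "rep_edge E X R D f e (point_mass X y) = (point_mass X (f e y) :: 'x \<Rightarrow> 'k::field)"
proof -
  have "(if x \<in> R e then point_mass X y (inv_into (D (head E e)) (f e) x) else 0) =
      (if x = f e y then 1 else (0 :: 'k))" for x
  proof (cases "x \<in> R e")
    case True
    then obtain z where z: "z \<in> D (head E e)" "x = f e z" using assms(1) by (auto simp: bij_betw_def)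
    then have "inv_into (D (head E e)) (f e) x = z" "x = f e y \<longleftrightarrow> z = y"
      using assms(1,2) by (auto simp: bij_betw_def inv_into_f_f inj_on_eq_iff)
    then show ?thesis using True z assms(3) by (auto simp: point_mass_def)
  next
    case False
    then show ?thesis using assms(1,2) by (auto simp: bij_betw_def)
  qed
  then show ?thesis
    unfolding rep_edge_def by (simp add: point_mass_def[of X "f e y"] cong: restrict_cong)
qed

text \<open>Every element of the Leavitt path algebra is the class of a term, so results about
  \<open>term_value\<close> reach all of its elements.\<close>

lemma term_value_leavitt:
  "term_over E x \<Longrightarrow> term_value (leavitt_algebra E) (leavitt_vertex E) (leavitt_edge E) (leavitt_ghost E) x
     = leavitt_class E x"
  by (induction x) simp_all

section \<open>Kernels of algebra homomorphisms\<close>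

lemma algebra_hom_add: "h \<in> algebra_hom A B \<Longrightarrow> x \<in> carrier A \<Longrightarrow> y \<in> carrier A \<Longrightarrow>
    h (x \<oplus>\<^bsub>A\<^esub> y) = h x \<oplus>\<^bsub>B\<^esub> h y"
  and algebra_hom_mult: "h \<in> algebra_hom A B \<Longrightarrow> x \<in> carrier A \<Longrightarrow> y \<in> carrier A \<Longrightarrow>
    h (x \<otimes>\<^bsub>A\<^esub> y) = h x \<otimes>\<^bsub>B\<^esub> h y"
  and algebra_hom_smult: "h \<in> algebra_hom A B \<Longrightarrow> x \<in> carrier A \<Longrightarrow> h (c \<odot>\<^bsub>A\<^esub> x) = c \<odot>\<^bsub>B\<^esub> h x"
  and algebra_hom_closed: "h \<in> algebra_hom A B \<Longrightarrow> x \<in> carrier A \<Longrightarrow> h x \<in> carrier B"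
  by (auto simp: algebra_hom_def)

text \<open>Preservation of zero is not part of \<open>algebra_hom\<close>; it follows from the
  scalar 0.\<close>

lemma algebra_hom_zero:
  assumes "field_algebra A" "field_algebra B" "h \<in> algebra_hom A B"
  shows "h \<zero>\<^bsub>A\<^esub> = \<zero>\<^bsub>B\<^esub>"
proof -
  interpret A: field_algebra A by fact
  interpret B: field_algebra B by fact
  have "h (0 \<odot>\<^bsub>A\<^esub> \<zero>\<^bsub>A\<^esub>) = 0 \<odot>\<^bsub>B\<^esub> h \<zero>\<^bsub>A\<^esub>"
    using algebra_hom_smult[OF assms(3)] by simp
  then show ?thesis
    using algebra_hom_closed[OF assms(3), of "\<zero>\<^bsub>A\<^esub>"] by (simp add: A.smult_zero B.smult_zero)
qed

lemma algebra_hom_injI: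
  assumes "field_algebra A" "field_algebra B" and h: "h \<in> algebra_hom A B"
    and ker: "\<And>x. x \<in> carrier A \<Longrightarrow> h x = \<zero>\<^bsub>B\<^esub> \<Longrightarrow> x = \<zero>\<^bsub>A\<^esub>"
  shows "inj_on h (carrier A)"
proof (rule inj_onI)
  interpret A: field_algebra A by fact
  interpret B: field_algebra B by fact
  fix x y assume x: "x \<in> carrier A" and y: "y \<in> carrier A" and eq: "h x = h y"
  define z where "z = (- 1) \<odot>\<^bsub>A\<^esub> x"
  have z: "z \<in> carrier A" "z \<oplus>\<^bsub>A\<^esub> x = \<zero>\<^bsub>A\<^esub>"
    using x by (auto simp: z_def A.smult_closed A.smult_minus)
  have "h (z \<oplus>\<^bsub>A\<^esub> y) = h (z \<oplus>\<^bsub>A\<^esub> x)"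
    using x y z(1) eq by (simp add: algebra_hom_add[OF h])
  then have "z \<oplus>\<^bsub>A\<^esub> y = z \<oplus>\<^bsub>A\<^esub> x"
    using ker[of "z \<oplus>\<^bsub>A\<^esub> y"] z x y algebra_hom_zero[OF assms(1-3)] by simp
  then show "x = y" using x y z(1) by simp
qed

text \<open>This isolates what the interval system must provide: at each vertex \<open>w\<close>, a
  point fixed by no nonempty closed path. The point mass there separates the paths ending at
  \<open>w\<close>, because they send it to point masses at distinct points.\<close>

theorem induced_rep_inj:
  fixes E :: "('v, 'e) pre_digraph" and X :: "'x set"
  assumes wf: "wf_digraph E" and row: "row_finite E" and sinks: "\<And>v. \<not> is_sink E v"
    and B: "algebraic_branching_system E X R D f"
    and free: "\<And>w. w \<in> verts E \<Longrightarrow>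
      \<exists>y\<in>D w. \<forall>\<mu>. \<mu> \<noteq> [] \<longrightarrow> pre_digraph.awalk E w \<mu> w \<longrightarrow> foldr f \<mu> y \<noteq> y"
  shows "inj_on (induced_rep E X R D f :: ('k::field, 'v, 'e) lterm set \<Rightarrow> ('x \<Rightarrow> 'k) \<Rightarrow> ('x \<Rightarrow> 'k))
    (carrier (leavitt_algebra E))"
proof (rule algebra_hom_injI[OF leavitt_field_algebra end_field_algebra])
  let ?L = "leavitt_algebra E :: ('k, ('k, 'v, 'e) lterm set) module"
  let ?H = "end_algebra X :: ('k, ('x \<Rightarrow> 'k) \<Rightarrow> ('x \<Rightarrow> 'k)) module"
  let ?\<pi> = "induced_rep E X R D f :: ('k, 'v, 'e) lterm set \<Rightarrow> ('x \<Rightarrow> 'k) \<Rightarrow> ('x \<Rightarrow> 'k)"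
  interpret L: leavitt_family_algebra ?L E "leavitt_vertex E" "leavitt_edge E" "leavitt_ghost E"
    using leavitt_generators[OF wf]
    by (intro leavitt_family_algebra.intro leavitt_field_algebra wf leavitt_family_algebra_axioms.intro)
  have hom: "?\<pi> \<in> algebra_hom ?L ?H"
    and V: "\<And>v. v \<in> verts E \<Longrightarrow> ?\<pi> (leavitt_vertex E v) = rep_vertex X D v"
    and S: "\<And>e. e \<in> arcs E \<Longrightarrow> ?\<pi> (leavitt_edge E e) = rep_edge E X R D f e"
    using induced_rep_properties[OF wf B] by blast+
  show "?\<pi> \<in> algebra_hom ?L ?H" by (rule hom)
  have DX: "D v \<subseteq> X" if "v \<in> verts E" for v
    using B that by (auto simp: algebraic_branching_system_def)
  have path: "?\<pi> (L.path_element \<mu> w) (point_mass X y) = point_mass X (foldr f \<mu> y)"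
    if "L.awalk u \<mu> w" "y \<in> D w" for u \<mu> w y
    using that
  proof (induction \<mu> arbitrary: u)
    case Nil
    then have w: "w \<in> verts E" by (auto simp: L.awalk_Nil_iff)
    have "(\<lambda>x\<in>X. if x \<in> D w then point_mass X y x else 0) = (point_mass X y :: 'x \<Rightarrow> 'k)"
      using Nil(2) DX[OF w] by (auto simp: point_mass_def fun_eq_iff)
    then show ?case using V[OF w] by (simp add: rep_vertex_def)
  next
    case (Cons e \<mu>)
    then have e: "e \<in> arcs E" and \<mu>: "L.awalk (head E e) \<mu> w" by (auto simp: L.awalk_Cons_iff)
    have "?\<pi> (L.path_element (e # \<mu>) w) = ?\<pi> (leavitt_edge E e) \<otimes>\<^bsub>?H\<^esub> ?\<pi> (L.path_element \<mu> w)"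
      using algebra_hom_mult[OF hom L.edge_closed[OF e] L.path_element_closed[OF \<mu>]]
      by (simp del: leavitt_mult)
    then have "?\<pi> (L.path_element (e # \<mu>) w) (point_mass X y) =
        ?\<pi> (leavitt_edge E e) (?\<pi> (L.path_element \<mu> w) (point_mass X y))"
      by (simp add: end_algebra_simps compose_def)
    also have "\<dots> = rep_edge E X R D f e (point_mass X (foldr f \<mu> y))"
      using Cons.IH[OF \<mu> Cons.prems(2)] S[OF e] by simp
    also have "\<dots> = point_mass X (f e (foldr f \<mu> y))"
      using L.branching_edge(2)[OF B e] L.branching_path[OF B \<mu> Cons.prems(2)] DX e
      by (intro rep_edge_point_mass) auto
    finally show ?case by simp
  qed
  fix x assume "x \<in> carrier ?L" and zero: "?\<pi> x = \<zero>\<^bsub>?H\<^esub>"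
  then obtain \<tau> where \<tau>: "term_over E \<tau>" "x = leavitt_class E \<tau>" by auto
  have x: "x = term_value ?L (leavitt_vertex E) (leavitt_edge E) (leavitt_ghost E) \<tau>"
    using term_value_leavitt[OF \<tau>(1)] \<tau>(2) by simp
  show "x = \<zero>\<^bsub>?L\<^esub>"
  proof (rule ccontr)
    assume "x \<noteq> \<zero>\<^bsub>?L\<^esub>"
    then obtain u \<nu> w F c where \<nu>: "L.awalk u \<nu> w" and F: "finite F" "F \<subseteq> {\<mu>. \<exists>u. L.awalk u \<mu> w}"
      and nz: "x \<otimes>\<^bsub>?L\<^esub> L.path_element \<nu> w \<noteq> \<zero>\<^bsub>?L\<^esub>"
      and sum: "x \<otimes>\<^bsub>?L\<^esub> L.path_element \<nu> w = (\<Oplus>\<^bsub>?L\<^esub>\<mu>\<in>F. c \<mu> \<odot>\<^bsub>?L\<^esub> L.path_element \<mu> w)"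
      using L.nonzero_times_path[OF row sinks \<tau>(1)] unfolding x by blast
    have w: "w \<in> verts E" using \<nu> by (rule L.awalk_last_in_verts)
    obtain y where y: "y \<in> D w" "\<And>\<mu>. \<mu> \<noteq> [] \<Longrightarrow> L.awalk w \<mu> w \<Longrightarrow> foldr f \<mu> y \<noteq> y"
      using free[OF w] by blast
    \<comment> \<open>Stated for subsets of \<open>F\<close>, so that it can be proved by induction
      on the index set.\<close>
    have point_value: "?\<pi> (\<Oplus>\<^bsub>?L\<^esub>\<mu>\<in>F'. c \<mu> \<odot>\<^bsub>?L\<^esub> L.path_element \<mu> w) (point_mass X y) z =
        (\<Sum>\<mu>\<in>F'. c \<mu> * point_mass X (foldr f \<mu> y) z)"
      if "finite F'" "F' \<subseteq> F" "z \<in> X" for F' z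
      using that(1,2)
    proof (induction F')
      case empty
      then show ?case
        using algebra_hom_zero[OF leavitt_field_algebra end_field_algebra hom] that(3)
        by (simp add: end_algebra_simps del: leavitt_zero)
    next
      case (insert \<mu> F')
      have cl: "L.path_element \<mu>' w \<in> carrier ?L" if "\<mu>' \<in> F" for \<mu>'
        using F(2) that by (auto intro: L.path_element_closed simp del: leavitt_carrier)
      then have cl': "c \<mu>' \<odot>\<^bsub>?L\<^esub> L.path_element \<mu>' w \<in> carrier ?L" if "\<mu>' \<in> F" for \<mu>'
        using that by (intro L.smult_closed)
      have \<mu>: "\<mu> \<in> F" "F' \<subseteq> F" using insert.prems by auto
      obtain u where u: "L.awalk u \<mu> w" using F(2) \<mu>(1) by blast
      have "(\<Oplus>\<^bsub>?L\<^esub>\<mu>\<in>insert \<mu> F'. c \<mu> \<odot>\<^bsub>?L\<^esub> L.path_element \<mu> w) =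
          c \<mu> \<odot>\<^bsub>?L\<^esub> L.path_element \<mu> w \<oplus>\<^bsub>?L\<^esub> (\<Oplus>\<^bsub>?L\<^esub>\<mu>\<in>F'. c \<mu> \<odot>\<^bsub>?L\<^esub> L.path_element \<mu> w)"
        using insert.hyps cl' \<mu> by (intro L.finsum_insert) (auto simp del: leavitt_carrier)
      moreover have "(\<Oplus>\<^bsub>?L\<^esub>\<mu>\<in>F'. c \<mu> \<odot>\<^bsub>?L\<^esub> L.path_element \<mu> w) \<in> carrier ?L"
        using cl' \<mu>(2) by (intro L.finsum_closed) (auto simp del: leavitt_carrier)
      ultimately have "?\<pi> (\<Oplus>\<^bsub>?L\<^esub>\<mu>\<in>insert \<mu> F'. c \<mu> \<odot>\<^bsub>?L\<^esub> L.path_element \<mu> w) =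
          c \<mu> \<odot>\<^bsub>?H\<^esub> ?\<pi> (L.path_element \<mu> w) \<oplus>\<^bsub>?H\<^esub> ?\<pi> (\<Oplus>\<^bsub>?L\<^esub>\<mu>\<in>F'. c \<mu> \<odot>\<^bsub>?L\<^esub> L.path_element \<mu> w)"
        using algebra_hom_add[OF hom cl'[OF \<mu>(1)]] algebra_hom_smult[OF hom cl[OF \<mu>(1)]] by simp
      then show ?case
        using insert.hyps insert.IH[OF \<mu>(2)] path[OF u y(1)] that(3)
        by (simp add: end_algebra_simps fun_add_def fun_scale_def)
    qed
    have "?\<pi> (x \<otimes>\<^bsub>?L\<^esub> L.path_element \<nu> w) = \<zero>\<^bsub>?H\<^esub> \<otimes>\<^bsub>?H\<^esub> ?\<pi> (L.path_element \<nu> w)"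
      using algebra_hom_mult[OF hom \<open>x \<in> carrier ?L\<close> L.path_element_closed[OF \<nu>]] zero by simp
    also have "\<dots> = \<zero>\<^bsub>?H\<^esub>"
      by (rule field_algebra.mult_zero_l[OF end_field_algebra algebra_hom_closed[OF hom L.path_element_closed[OF \<nu>]]])
    finally have sum0: "(\<Sum>\<mu>\<in>F. c \<mu> * point_mass X (foldr f \<mu> y) z) = 0" if "z \<in> X" for z
      using point_value[OF F(1) order_refl that] that unfolding sum by (simp add: end_algebra_simps)
    have "c \<mu> = 0" if \<mu>: "\<mu> \<in> F" for \<mu>
    proof -
      obtain u where u: "L.awalk u \<mu> w" using F(2) \<mu> by blast
      have z: "foldr f \<mu> y \<in> X"
        using L.branching_path[OF B u y(1)] DX L.awalk_hd_in_verts[OF u] by blast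
      \<comment> \<open>Evaluation at the image of \<open>y\<close> along \<mu> isolates the
        coefficient of \<mu>.\<close>
      have "point_mass X (foldr f \<mu>' y) (foldr f \<mu> y) = (if \<mu>' = \<mu> then 1 else (0 :: 'k))" if \<mu>': "\<mu>' \<in> F" for \<mu>'
      proof -
        obtain u' where u': "L.awalk u' \<mu>' w" using F(2) \<mu>' by blast
        have "\<mu>' = \<mu>" if "foldr f \<mu> y = foldr f \<mu>' y"
          using L.branching_path_inj[OF B y u u' that] by simp
        then show ?thesis using z by (auto simp: point_mass_def)
      qed
      then have "(\<Sum>\<mu>'\<in>F. c \<mu>' * point_mass X (foldr f \<mu>' y) (foldr f \<mu> y)) = (\<Sum>\<mu>'\<in>F. if \<mu>' = \<mu> then c \<mu>' else 0)"
        by (intro sum.cong) auto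
      then show ?thesis using sum0[OF z] F(1) \<mu> by simp
    qed
    then have "(\<Oplus>\<^bsub>?L\<^esub>\<mu>\<in>F. c \<mu> \<odot>\<^bsub>?L\<^esub> L.path_element \<mu> w) = (\<Oplus>\<^bsub>?L\<^esub>\<mu>\<in>F. \<zero>\<^bsub>?L\<^esub>)"
      using F(2) L.path_element_closed
      by (intro L.finsum_cong') (auto intro!: L.smult_zero simp del: leavitt_carrier leavitt_zero leavitt_smult)
    then show False using nz unfolding sum by (simp del: leavitt_zero)
  qed
qed

section \<open>Affine form of the interval maps\<close>

text \<open>On each piece the map rotates by \<theta> and contracts by \<open>1 / P\<close>. The
  piece and the integer part removed by the rotation depend on \<open>x\<close>, hence so does
  \<open>r\<close>, but it stays rational.\<close>

lemma interval_f_affine: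
  assumes E: "countable_graph E" "row_finite E" "\<forall>v. \<not> is_sink E v"
    and en: "edge_enumeration E I en" and l: "successor_listing E l"
    and e: "e \<in> arcs E" and x: "x \<in> interval_D E I en (head E e)"
  shows "\<exists>a\<in>\<rat>. \<exists>r\<in>\<rat>. 0 < a \<and> interval_f E I en l \<theta> e x = a * (x + \<theta>) + r"
proof -
  interpret wf_digraph E using E by (simp add: countable_graph_def)
  note B = interval_branching_system[OF E en l]
  define P where "P = card (out_arcs E (head E e))"
  define j where "j = real (edge_index I en e)"
  define k where "k = (THE k. k \<in> {1..P} \<and> x \<in> interval_R I en (l e k))"
  define i where "i = real (edge_index I en (l e k))"
  have P: "0 < P"
    using E e by (auto simp: P_def row_finite_def is_sink_def card_gt_0_iff)
  have lb: "bij_betw (l e) {1..P} (out_arcs E (head E e))"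
    using l e by (auto simp: successor_listing_def P_def)
  obtain e' where e': "e' \<in> out_arcs E (head E e)" "x \<in> interval_R I en e'"
    using x by (auto simp: interval_D_def)
  obtain k' where k': "k' \<in> {1..P}" "e' = l e k'"
    using lb e'(1) unfolding bij_betw_def by blast
  \<comment> \<open>Disjointness of the intervals makes the definite description in
    \<open>interval_f\<close> meaningful at \<open>x\<close>.\<close>
  have "\<exists>!k. k \<in> {1..P} \<and> x \<in> interval_R I en (l e k)"
  proof (rule ex1I[of _ k'])
    show "k' \<in> {1..P} \<and> x \<in> interval_R I en (l e k')" using k' e' by simp
    fix m assume m: "m \<in> {1..P} \<and> x \<in> interval_R I en (l e m)"
    then have "l e m \<in> arcs E" using bij_betwE[OF lb] by auto
    then have "l e m = l e k'" using branching_disjoint(1)[OF B, of "l e m" e' x] m e' k' by simp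
    then show "m = k'" using lb m k'(1) by (auto simp: bij_betw_def dest: inj_onD)
  qed
  from theI'[OF this] have "x \<in> interval_R I en (l e k)" by (simp add: k_def)
  then have "inv_into {0..<1} (affine_param (i - 1) i) x = x - i + 1"
    using inv_into_affine_param[of "x - i + 1" i] by (simp add: interval_R_def i_def)
  then have "interval_f E I en l \<theta> e x =
      affine_param (j - 1 + (real k - 1) / P) (j - 1 + real k / P) (circle_rotation \<theta> (x - i + 1))"
    unfolding interval_f_def Let_def P_def[symmetric] j_def[symmetric] k_def[symmetric] i_def[symmetric]
    by simp
  also have "\<dots> = j - 1 + (real k - 1 + frac (x - i + 1 + \<theta>)) / P"
    by (simp add: affine_param_def circle_rotation_def add_divide_distrib diff_divide_distrib algebra_simps)
  \<comment> \<open>Writing the fractional part as its argument minus an integer exposes the affine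
    form.\<close>
  also have "\<dots> = 1 / P * (x + \<theta>) + (j - 1 + (real k - i - of_int \<lfloor>x - i + 1 + \<theta>\<rfloor>) / P)"
    by (simp add: frac_def add_divide_distrib diff_divide_distrib algebra_simps)
  finally have "interval_f E I en l \<theta> e x = \<dots>" .
  moreover have "1 / real P \<in> \<rat>" "j - 1 + (real k - i - of_int \<lfloor>x - i + 1 + \<theta>\<rfloor>) / P \<in> \<rat>" "0 < 1 / real P"
    using P by (auto simp: j_def i_def)
  ultimately show ?thesis by blast
qed

text \<open>One more edge turns the coefficient \<open>q\<close> of \<theta> into
  \<open>b * (q + 1)\<close> with \<open>b > 0\<close>. Contributions of \<theta> therefore never
  cancel, and \<open>q\<close> is positive for every nonempty path.\<close>

lemma interval_path_affine:
  assumes E: "countable_graph E" "row_finite E" "\<forall>v. \<not> is_sink E v"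
    and en: "edge_enumeration E I en" and l: "successor_listing E l"
    and y: "y \<in> interval_D E I en w" and "pre_digraph.awalk E u \<mu> w"
  shows "\<exists>a\<in>\<rat>. \<exists>q\<in>\<rat>. \<exists>r\<in>\<rat>. 0 \<le> q \<and> (\<mu> \<noteq> [] \<longrightarrow> 0 < q) \<and>
    foldr (interval_f E I en l \<theta>) \<mu> y = a * y + q * \<theta> + r"
proof -
  interpret wf_digraph E using E by (simp add: countable_graph_def)
  note B = interval_branching_system[OF E en l]
  show ?thesis using assms(7)
  proof (induction \<mu> arbitrary: u)
    case Nil
    \<comment> \<open>The empty path is the identity: slope 1, and both \<open>q\<close> and
      \<open>r\<close> are 0.\<close>
    show ?case by (intro bexI[of _ 1] bexI[of _ 0]) auto
  next
    case (Cons e \<mu>)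
    then have e: "e \<in> arcs E" and \<mu>: "awalk (head E e) \<mu> w" by (auto simp: awalk_Cons_iff)
    obtain a q r where aqr: "a \<in> \<rat>" "q \<in> \<rat>" "r \<in> \<rat>" "0 \<le> q"
      "foldr (interval_f E I en l \<theta>) \<mu> y = a * y + q * \<theta> + r"
      using Cons.IH[OF \<mu>] by blast
    obtain b s where bs: "b \<in> \<rat>" "s \<in> \<rat>" "0 < b"
      "interval_f E I en l \<theta> e (a * y + q * \<theta> + r) = b * (a * y + q * \<theta> + r + \<theta>) + s"
      using interval_f_affine[OF E en l e, of "a * y + q * \<theta> + r" \<theta>] branching_path[OF B \<mu> y, of \<theta>] aqr(5)
      by auto
    have "foldr (interval_f E I en l \<theta>) (e # \<mu>) y = (b * a) * y + (b * (q + 1)) * \<theta> + (b * r + s)"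
      using aqr(5) bs(4) by (simp add: algebra_simps)
    moreover have "b * a \<in> \<rat>" "b * (q + 1) \<in> \<rat>" "b * r + s \<in> \<rat>" "0 < b * (q + 1)"
      using aqr(1-4) bs(1-3) by auto
    ultimately show ?case by (metis less_imp_le)
  qed
qed

text \<open>The rational combinations of \<theta> and 1 form a countable set, whereas a
  nondegenerate interval is uncountable.\<close>

lemma exists_not_rational_combination:
  fixes a b \<theta> :: real
  assumes "a < b"
  shows "\<exists>y\<in>{a..<b}. \<forall>q\<in>\<rat>. \<forall>r\<in>\<rat>. y \<noteq> q * \<theta> + r"
proof (rule ccontr)
  assume "\<not> ?thesis"
  then have "{a..<b} \<subseteq> (\<lambda>(q, r). q * \<theta> + r) ` (\<rat> \<times> \<rat>)" by auto
  moreover have "countable ((\<lambda>(q, r). q * \<theta> + r) ` (\<rat> \<times> \<rat>))"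
    by (intro countable_image countable_SIGMA countable_rat)
  ultimately have "countable {a..<b}" by (rule countable_subset)
  then show False using assms uncountable_half_open_interval_1[of a b] by simp
qed

theorem corollary4p3:
  fixes E :: "('v, 'e) pre_digraph"
    and I :: "nat set" and en :: "nat \<Rightarrow> 'e" and l :: "'e \<Rightarrow> nat \<Rightarrow> 'e"
    and \<theta> :: real
  assumes "countable_graph E" and "row_finite E" and "\<forall>v. \<not> is_sink E v"
    and "edge_enumeration E I en" and "successor_listing E l"
    and "0 \<le> \<theta>" and "\<theta> < 1" and "\<theta> \<notin> \<rat>"
  shows "inj_on
    (induced_rep E (interval_X E I en) (interval_R I en) (interval_D E I en)
       (interval_f E I en l \<theta>)
       :: ('k::field, 'v, 'e) lterm set \<Rightarrow> (real \<Rightarrow> 'k) \<Rightarrow> (real \<Rightarrow> 'k))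
    (carrier (leavitt_algebra E))"
proof (rule induced_rep_inj)
  show "wf_digraph E" using assms(1) by (simp add: countable_graph_def)
  show "algebraic_branching_system E (interval_X E I en) (interval_R I en) (interval_D E I en)
      (interval_f E I en l \<theta>)"
    by (rule interval_branching_system[OF assms(1-5)])
  fix w assume w: "w \<in> verts E"
  \<comment> \<open>Since \<open>w\<close> is not a sink, its set contains a whole unit interval
    from which \<open>y\<close> can be chosen.\<close>
  then obtain e where e: "e \<in> out_arcs E w" using assms(3) unfolding is_sink_def by blast
  obtain y where "y \<in> interval_R I en e" and irr: "\<And>q r. q \<in> \<rat> \<Longrightarrow> r \<in> \<rat> \<Longrightarrow> y \<noteq> q * \<theta> + r"
    using exists_not_rational_combination[of "real (edge_index I en e) - 1" "real (edge_index I en e)" \<theta>]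
    unfolding interval_R_def by auto
  then have y: "y \<in> interval_D E I en w" using e by (auto simp: interval_D_def)
  have "foldr (interval_f E I en l \<theta>) \<mu> y \<noteq> y" if \<mu>: "\<mu> \<noteq> []" "pre_digraph.awalk E w \<mu> w" for \<mu>
  proof
    assume fixed: "foldr (interval_f E I en l \<theta>) \<mu> y = y"
    obtain a q r where aqr: "a \<in> \<rat>" "q \<in> \<rat>" "r \<in> \<rat>" "0 < q" "y = a * y + q * \<theta> + r"
      using interval_path_affine[OF assms(1-5) y \<mu>(2), of \<theta>] \<mu>(1) fixed by metis
    show False
    \<comment> \<open>For \<open>a = 1\<close> the point \<open>y\<close> cancels and, as
      \<open>q > 0\<close>, \<theta> would be rational. Otherwise the equation can be solved for
      \<open>y\<close>, which becomes a rational combination of \<theta> and 1.\<close>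
    proof (cases "a = 1")
      case True
      then have "\<theta> = - r / q" using aqr by (simp add: field_simps)
      then show False using aqr(2,3) assms(8) by (metis Rats_divide Rats_minus_iff)
    next
      case False
      have "y * (1 - a) = q * \<theta> + r" using aqr(5) by (simp add: algebra_simps)
      then have "y = (q * \<theta> + r) / (1 - a)" using False by (simp add: eq_divide_eq)
      then have "y = q / (1 - a) * \<theta> + r / (1 - a)" by (simp add: add_divide_distrib)
      then show False using irr[of "q / (1 - a)" "r / (1 - a)"] aqr(1-3) by simp
    qed
  qed
  then show "\<exists>y\<in>interval_D E I en w. \<forall>\<mu>. \<mu> \<noteq> [] \<longrightarrow> pre_digraph.awalk E w \<mu> w \<longrightarrow>
      foldr (interval_f E I en l \<theta>) \<mu> y \<noteq> y"
    using y by blast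
qed (use assms in simp_all)

end
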